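(* Let $X$ be a paracompact space and let $\mathcal F$ be a family of maps between CW complexes. Then $X\tau_{cm}\mathcal F$ if and only if $\beta(X)\tau\mathcal F$.
   Context: Paracompact spaces are Hausdorff; $\beta(X)$ is the Čech–Stone compactification of $X$. A compact map is a continuous function whose image is contained in a compact subset of the target. For a map $i\colon K\to L$ between CW complexes and a space $X$: $X\tau i$ means that for every closed $A\subset X$ and every map $f\colon A\to K$ there is a map $F\colon X\to L$ with $F|_A=i\circ f$; $X\tau_{cm}i$ means that for every closed $A\subset X$ and every compact map $f\colon A\to K$ there is a compact map $F\colon X\to L$ with $F|_A=i\circ f$. For a family $\mathcal F$ of maps between CW complexes, $X\tau\mathcal F$ (respectively $X\tau_{cm}\mathcal F$) means $X\tau i$ (respectively $X\tau_{cm}i$) for all $i\in\mathcal F$. *)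

theory Defs
  imports "HOL-Analysis.Analysis"
begin

definition paracompact_space :: "'a topology \<Rightarrow> bool" where
  "paracompact_space X \<longleftrightarrow>
     Hausdorff_space X \<and>
     (\<forall>\<U>. (\<forall>U\<in>\<U>. openin X U) \<and> \<Union>\<U> = topspace X \<longrightarrow>
        (\<exists>\<V>. (\<forall>V\<in>\<V>. openin X V) \<and> \<Union>\<V> = topspace X \<and>
             (\<forall>V\<in>\<V>. \<exists>U\<in>\<U>. V \<subseteq> U) \<and> locally_finite_in X \<V>))"

text \<open>
  The Cech--Stone compactification, constructed as the closure of the image of \<open>X\<close> in the cube
  with one coordinate for each continuous function from \<open>X\<close> to the unit interval.
  Extensionality makes these functions on the carrier of \<open>X\<close> rather than on its ambient type.
\<close>

definition unit_functions :: "'a topology \<Rightarrow> ('a \<Rightarrow> real) set" where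
  "unit_functions X =
     {h \<in> extensional (topspace X). continuous_map X (top_of_set {0..1}) h}"

definition stone_cech_cube :: "'a topology \<Rightarrow> (('a \<Rightarrow> real) \<Rightarrow> real) topology" where
  "stone_cech_cube X = product_topology (\<lambda>h. top_of_set {0..1}) (unit_functions X)"

definition stone_cech_map :: "'a topology \<Rightarrow> 'a \<Rightarrow> ('a \<Rightarrow> real) \<Rightarrow> real" where
  "stone_cech_map X x = (\<lambda>h\<in>unit_functions X. h x)"

definition stone_cech :: "'a topology \<Rightarrow> (('a \<Rightarrow> real) \<Rightarrow> real) topology" where
  "stone_cech X =
     subtopology (stone_cech_cube X)
       (stone_cech_cube X closure_of (stone_cech_map X ` topspace X))"

definition closed_disc :: "nat \<Rightarrow> (nat \<Rightarrow> real) topology" where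
  "closed_disc n = subtopology (Euclidean_space n) {x. (\<Sum>i<n. (x i)\<^sup>2) \<le> 1}"

definition open_disc :: "nat \<Rightarrow> (nat \<Rightarrow> real) set" where
  "open_disc n = {x \<in> topspace (Euclidean_space n). (\<Sum>i<n. (x i)\<^sup>2) < 1}"

definition disc_boundary :: "nat \<Rightarrow> (nat \<Rightarrow> real) set" where
  "disc_boundary n = {x \<in> topspace (Euclidean_space n). (\<Sum>i<n. (x i)\<^sup>2) = 1}"

text \<open>
  Whitehead's definition. A pair \<open>(n, e)\<close> in \<open>E\<close> is an open cell \<open>e\<close> of dimension \<open>n\<close>, and
  \<open>\<Phi>\<close> is a characteristic map for it. Closure finiteness is the inner existential over \<open>D\<close>; the
  last clause is the weak topology (its converse is automatic, closures being closed).
\<close>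

definition CW_structure :: "'a topology \<Rightarrow> (nat \<times> 'a set) set \<Rightarrow> bool" where
  "CW_structure X E \<longleftrightarrow>
     Hausdorff_space X \<and>
     (\<Union>(n, e)\<in>E. e) = topspace X \<and>
     disjoint_family_on snd E \<and>
     (\<forall>(n, e)\<in>E. \<exists>\<Phi>.
        continuous_map (closed_disc n) X \<Phi> \<and>
        homeomorphic_map (subtopology (closed_disc n) (open_disc n)) (subtopology X e) \<Phi> \<and>
        (\<exists>D\<subseteq>E. finite D \<and> (\<forall>(m, d)\<in>D. m < n) \<and>
           \<Phi> ` disc_boundary n \<subseteq> (\<Union>(m, d)\<in>D. d))) \<and>
     (\<forall>C\<subseteq>topspace X.
        (\<forall>(n, e)\<in>E. closedin X (C \<inter> X closure_of e)) \<longrightarrow> closedin X C)"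

definition CW_complex :: "'a topology \<Rightarrow> bool" where
  "CW_complex X \<longleftrightarrow> (\<exists>E. CW_structure X E)"

definition compact_map :: "'a topology \<Rightarrow> 'b topology \<Rightarrow> ('a \<Rightarrow> 'b) \<Rightarrow> bool" where
  "compact_map X Y f \<longleftrightarrow>
     continuous_map X Y f \<and> (\<exists>S. compactin Y S \<and> f ` topspace X \<subseteq> S)"

definition tau :: "'a topology \<Rightarrow> 'k topology \<Rightarrow> 'l topology \<Rightarrow> ('k \<Rightarrow> 'l) \<Rightarrow> bool" where
  "tau X K L i \<longleftrightarrow>
     (\<forall>A f. closedin X A \<and> continuous_map (subtopology X A) K f \<longrightarrow>
        (\<exists>F. continuous_map X L F \<and> (\<forall>x\<in>A. F x = i (f x))))"

definition tau_cm :: "'a topology \<Rightarrow> 'k topology \<Rightarrow> 'l topology \<Rightarrow> ('k \<Rightarrow> 'l) \<Rightarrow> bool" where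
  "tau_cm X K L i \<longleftrightarrow>
     (\<forall>A f. closedin X A \<and> compact_map (subtopology X A) K f \<longrightarrow>
        (\<exists>F. compact_map X L F \<and> (\<forall>x\<in>A. F x = i (f x))))"

text \<open>
  A map \<open>i: K \<rightarrow> L\<close> is recorded together with its source and target topologies as \<open>(K, L, i)\<close>.
\<close>

type_synonym ('k, 'l) map_family = "('k topology \<times> 'l topology \<times> ('k \<Rightarrow> 'l)) set"

definition CW_map_family :: "('k, 'l) map_family \<Rightarrow> bool" where
  "CW_map_family \<F> \<longleftrightarrow>
     (\<forall>(K, L, i)\<in>\<F>. CW_complex K \<and> CW_complex L \<and> continuous_map K L i)"

definition tau_family :: "'a topology \<Rightarrow> ('k, 'l) map_family \<Rightarrow> bool" where
  "tau_family X \<F> \<longleftrightarrow> (\<forall>(K, L, i)\<in>\<F>. tau X K L i)"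

definition tau_cm_family :: "'a topology \<Rightarrow> ('k, 'l) map_family \<Rightarrow> bool" where
  "tau_cm_family X \<F> \<longleftrightarrow> (\<forall>(K, L, i)\<in>\<F>. tau_cm X K L i)"

end

theory Submission
  imports Defs
begin

text \<open>
  If \<open>\<beta>(X) \<tau> i\<close>, a compact map \<open>f: A \<rightarrow> K\<close> extends over the closure of \<open>A\<close> in \<open>\<beta>(X)\<close>, because \<open>X\<close> is
  normal and the image lies in a compact Hausdorff space; the solution over \<open>\<beta>(X)\<close> restricts to \<open>X\<close>.
  Conversely, let \<open>f: B \<rightarrow> K\<close> with \<open>B\<close> closed in \<open>\<beta>(X)\<close>. Its image lies in a finite subcomplex, which
  is a neighbourhood retract of \<open>\<real>\<^sup>\<nat>\<close>, so \<open>f\<close> extends to a closed neighbourhood \<open>N\<close> of \<open>B\<close>. The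
  hypothesis on \<open>X\<close> applies to this extension on \<open>N \<inter> X\<close>, and its solution extends to \<open>\<beta>(X)\<close>. The
  two maps agree on \<open>B\<close> because \<open>N \<inter> X\<close> is dense near \<open>B\<close>.
\<close>

subsection \<open>Paracompact spaces are normal\<close>

text \<open>A closed set \<open>B\<close> of \<beta>(X) may miss the image of X altogether, so that
  a map on \<open>B\<close> alone gives the hypothesis on X nothing to act on; this forces the
  passage to a neighbourhood. Compactness is needed twice on the way back. The thickened map has to
  take values in one compact set, since only then is its composite with the map from X a compact
  map; and the solution on X has to be compact, since maps extend over \<beta>(X) when the target is
  compact Hausdorff. Finite complexes are shown to be neighbourhood retracts by attaching one cell
  at a time. The difficulty lies where the cell meets what is already there: a retraction near the
  open cell and one near its boundary have to be glued. Sequences serve as ambient space because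
  they hold all finite complexes in a single type, leave room for the coordinates of each new cell,
  and let the Tietze theorem act coordinate by coordinate.\<close>

lemma paracompact_space_shrink:
  assumes X: "paracompact_space X" and C: "closedin X C"
    and sep: "\<And>c. c \<in> C \<Longrightarrow> \<exists>U. openin X U \<and> c \<in> U \<and> X closure_of U \<inter> D = {}"
  obtains V where "openin X V" "C \<subseteq> V" "X closure_of V \<inter> D = {}"
proof -
  \<comment> \<open>The complement of \<open>C\<close> completes the sets given by
    \<open>sep\<close> to a cover. A member of a refinement that meets \<open>C\<close> cannot lie
    in that complement, so its closure misses \<open>D\<close>; local finiteness passes this to the
    union of all such members.\<close>
  define \<U> where "\<U> = insert (topspace X - C) {U. openin X U \<and> X closure_of U \<inter> D = {}}"
  have "\<forall>U\<in>\<U>. openin X U" using C by (auto simp: \<U>_def)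
  moreover have "\<Union>\<U> = topspace X"
  proof
    show "\<Union>\<U> \<subseteq> topspace X" by (auto simp: \<U>_def dest: openin_subset)
    show "topspace X \<subseteq> \<Union>\<U>"
    proof
      fix x assume "x \<in> topspace X"
      then show "x \<in> \<Union>\<U>" using sep[of x] by (cases "x \<in> C") (auto simp: \<U>_def)
    qed
  qed
  ultimately have "\<exists>\<V>. (\<forall>V\<in>\<V>. openin X V) \<and> \<Union>\<V> = topspace X \<and>
      (\<forall>V\<in>\<V>. \<exists>U\<in>\<U>. V \<subseteq> U) \<and> locally_finite_in X \<V>"
    using X unfolding paracompact_space_def by simp
  then obtain \<V> where "(\<forall>V\<in>\<V>. openin X V) \<and> \<Union>\<V> = topspace X \<and>
      (\<forall>V\<in>\<V>. \<exists>U\<in>\<U>. V \<subseteq> U) \<and> locally_finite_in X \<V>" ..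
  then have \<V>: "\<And>V. V \<in> \<V> \<Longrightarrow> openin X V" "\<Union>\<V> = topspace X"
      "\<And>V. V \<in> \<V> \<Longrightarrow> \<exists>U\<in>\<U>. V \<subseteq> U" "locally_finite_in X \<V>"
    by simp_all
  define \<W> where "\<W> = {V \<in> \<V>. V \<inter> C \<noteq> {}}"
  have lf: "locally_finite_in X \<W>"
    by (rule locally_finite_in_subset[OF \<V>(4)]) (auto simp: \<W>_def)
  have "X closure_of V \<inter> D = {}" if V: "V \<in> \<W>" for V
  proof -
    have "V \<in> \<V>" "V \<inter> C \<noteq> {}" using V by (auto simp: \<W>_def)
    then obtain U where "U \<in> \<U>" "V \<subseteq> U" using \<V>(3) by blast
    moreover have "\<not> V \<subseteq> topspace X - C" using \<open>V \<inter> C \<noteq> {}\<close> by auto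
    ultimately have "X closure_of U \<inter> D = {}" by (auto simp: \<U>_def)
    then show ?thesis using closure_of_mono[OF \<open>V \<subseteq> U\<close>, of X] by auto
  qed
  then have "X closure_of (\<Union>\<W>) \<inter> D = {}"
    unfolding closure_of_locally_finite_Union[OF lf] by auto
  moreover have "openin X (\<Union>\<W>)" using \<V>(1) by (auto simp: \<W>_def)
  moreover have "C \<subseteq> \<Union>\<W>"
  proof
    fix x assume "x \<in> C"
    then have "x \<in> \<Union>\<V>" using closedin_subset[OF C] \<V>(2) by auto
    with \<open>x \<in> C\<close> show "x \<in> \<Union>\<W>" by (auto simp: \<W>_def)
  qed
  ultimately show ?thesis using that by blast
qed

text \<open>Shrinking is used twice. With a single point as \<open>D\<close>, the Hausdorff property
  provides the local separation and the result is regularity; regularity is then the local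
  separation for two disjoint closed sets.\<close>

lemma paracompact_imp_normal_space:
  assumes "paracompact_space X"
  shows "normal_space X"
proof -
  have H: "Hausdorff_space X" using assms by (simp add: paracompact_space_def)
  have disjoint_closure: "X closure_of U \<inter> V = {}" if "openin X V" "U \<inter> V = {}" for U V
    using openin_Int_closure_of_eq_empty[OF that(1), of U] that(2) by blast
  have reg: "\<exists>U. openin X U \<and> c \<in> U \<and> X closure_of U \<inter> D = {}"
    if c: "c \<in> topspace X - D" and D: "closedin X D" for c D
  proof -
    have "\<exists>U. openin X U \<and> d \<in> U \<and> X closure_of U \<inter> {c} = {}" if d: "d \<in> D" for d
    proof -
      have "d \<in> topspace X" "d \<noteq> c" "c \<in> topspace X" using d c closedin_subset[OF D] by auto
      then obtain U V where "openin X U" "openin X V" "d \<in> U" "c \<in> V" "disjnt U V"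
        using H unfolding Hausdorff_space_def by meson
      moreover from this have "X closure_of U \<inter> V = {}"
        by (intro disjoint_closure) (simp_all add: disjnt_def)
      ultimately show ?thesis by blast
    qed
    then obtain V where V: "openin X V" "D \<subseteq> V" "X closure_of V \<inter> {c} = {}"
      by (rule paracompact_space_shrink[OF assms D])
    have "openin X (topspace X - X closure_of V)" by auto
    moreover have "X closure_of (topspace X - X closure_of V) \<inter> V = {}"
      using closure_of_subset[OF openin_subset[OF V(1)]] by (intro disjoint_closure V(1)) auto
    ultimately show ?thesis using V c by blast
  qed
  show ?thesis
    unfolding normal_space_def
  proof (intro allI impI)
    fix S T assume ST: "closedin X S \<and> closedin X T \<and> disjnt S T"
    then have "\<exists>U. openin X U \<and> c \<in> U \<and> X closure_of U \<inter> T = {}" if "c \<in> S" for c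
      using reg[of c T] that closedin_subset[of X S] by (auto simp: disjnt_def)
    then obtain V where V: "openin X V" "S \<subseteq> V" "X closure_of V \<inter> T = {}"
      by (rule paracompact_space_shrink[OF assms conjunct1[OF ST]])
    show "\<exists>U V. openin X U \<and> openin X V \<and> S \<subseteq> U \<and> T \<subseteq> V \<and> disjnt U V"
    proof (intro exI conjI)
      show "openin X V" "S \<subseteq> V" by (fact V)+
      show "openin X (topspace X - X closure_of V)" by auto
      show "T \<subseteq> topspace X - X closure_of V" using V(3) closedin_subset[of X T] ST by blast
      show "disjnt V (topspace X - X closure_of V)"
        using closure_of_subset[OF openin_subset[OF V(1)]] by (auto simp: disjnt_def)
    qed
  qed
qed

subsection \<open>Extension over the Cech--Stone compactification\<close>

lemma compact_space_stone_cech_cube: "compact_space (stone_cech_cube X)"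
  and Hausdorff_space_stone_cech_cube: "Hausdorff_space (stone_cech_cube X)"
  unfolding stone_cech_cube_def
  by (simp_all add: compact_space_product_topology compact_space_subtopology
      Hausdorff_space_product_topology Hausdorff_space_subtopology)

lemma compact_space_stone_cech: "compact_space (stone_cech X)"
  unfolding stone_cech_def
  by (simp add: closedin_compact_space compact_space_stone_cech_cube compact_space_subtopology)

lemma Hausdorff_space_stone_cech: "Hausdorff_space (stone_cech X)"
  unfolding stone_cech_def by (simp add: Hausdorff_space_stone_cech_cube Hausdorff_space_subtopology)

lemma normal_space_stone_cech: "normal_space (stone_cech X)"
  by (simp add: Hausdorff_space_stone_cech compact_Hausdorff_or_regular_imp_normal_space
      compact_space_stone_cech)

lemma continuous_map_stone_cech_cube: "continuous_map X (stone_cech_cube X) (stone_cech_map X)"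
  unfolding stone_cech_cube_def stone_cech_map_def
  by (auto simp: continuous_map_componentwise unit_functions_def)

lemma stone_cech_map_in_cube:
  "stone_cech_map X ` topspace X \<subseteq> topspace (stone_cech_cube X)"
  by (rule continuous_map_image_subset_topspace[OF continuous_map_stone_cech_cube])

lemma continuous_map_stone_cech_map: "continuous_map X (stone_cech X) (stone_cech_map X)"
  unfolding stone_cech_def continuous_map_in_subtopology
  using continuous_map_stone_cech_cube[of X] closure_of_subset[OF stone_cech_map_in_cube[of X]] by auto

lemma dense_stone_cech_map:
  "stone_cech X closure_of (stone_cech_map X ` topspace X) = topspace (stone_cech X)"
  unfolding stone_cech_def
  using closure_of_subset[OF stone_cech_map_in_cube, of X]
  by (simp add: closure_of_subtopology Int_absorb1 closure_of_subset_topspace)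

text \<open>Urysohn functions separate points, and a continuous injection of a compact space into a
  Hausdorff space is an embedding.\<close>

lemma embedding_map_stone_cech_cube:
  assumes "compact_space Y" "Hausdorff_space Y"
  shows "embedding_map Y (stone_cech_cube Y) (stone_cech_map Y)"
proof (rule continuous_imp_embedding_map)
  have nor: "normal_space Y" using assms compact_Hausdorff_or_regular_imp_normal_space by blast
  show "inj_on (stone_cech_map Y) (topspace Y)"
  proof (rule inj_onI, rule ccontr)
    fix x y assume xy: "x \<in> topspace Y" "y \<in> topspace Y" "stone_cech_map Y x = stone_cech_map Y y" "x \<noteq> y"
    have cl: "closedin Y {x}" "closedin Y {y}"
      using xy assms(2) by (simp_all add: closedin_Hausdorff_singleton)
    obtain h :: "_ \<Rightarrow> real" where h: "continuous_map Y (top_of_set {0..1}) h" "h ` {x} \<subseteq> {0}" "h ` {y} \<subseteq> {1}"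
      using Urysohn_lemma[OF nor cl, of 0 1] \<open>x \<noteq> y\<close> by auto
    \<comment> \<open>Only extensional functions index the cube, so the Urysohn function is cut down
      to the carrier.\<close>
    define k where "k = restrict h (topspace Y)"
    have "continuous_map Y (top_of_set {0..1}) k"
      by (rule continuous_map_eq[OF h(1)]) (simp add: k_def)
    then have "k \<in> unit_functions Y" by (simp add: unit_functions_def k_def)
    then have "k x = k y" using fun_cong[OF xy(3), of k] by (simp add: stone_cech_map_def)
    then show False using xy(1,2) h(2,3) by (simp add: k_def)
  qed
qed (use assms continuous_map_stone_cech_cube Hausdorff_space_stone_cech_cube in auto)

text \<open>Each unit function \<open>h\<close> on \<open>Y\<close> pulls back to \<open>A\<close>
  and extends by Tietze to a unit function \<open>k h\<close> on \<open>X\<close>. Reading off the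
  coordinates \<open>k h\<close> is a continuous map \<open>G\<close> from the cube of
  \<open>X\<close> to the cube of \<open>Y\<close>, and it induces the extension. For
  \<open>A\<close> the whole space this is the universal property of \<beta>(X).\<close>

lemma stone_cech_extension:
  fixes X :: "'a topology" and Y :: "'b topology"
  assumes nor: "normal_space X" and A: "closedin X A"
    and f: "continuous_map (subtopology X A) Y f" and Y: "compact_space Y" "Hausdorff_space Y"
  shows "\<exists>g. continuous_map (subtopology (stone_cech X) (stone_cech X closure_of (stone_cech_map X ` A))) Y g \<and>
    (\<forall>x\<in>A. g (stone_cech_map X x) = f x)"
proof -
  let ?B = "stone_cech X closure_of (stone_cech_map X ` A)"
  have AX: "A \<subseteq> topspace X" using closedin_subset[OF A] .
  have fA: "f x \<in> topspace Y" if "x \<in> A" for x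
    using continuous_map_image_subset_topspace[OF f] that AX by auto
  have "\<exists>k\<in>unit_functions X. \<forall>x\<in>A. k x = h (f x)" if h: "h \<in> unit_functions Y" for h
  proof -
    have "continuous_map (subtopology X A) (top_of_set {0..1}) (h \<circ> f)"
      using h by (intro continuous_map_compose[OF f]) (simp add: unit_functions_def)
    then have "continuous_map (subtopology X A) euclideanreal (h \<circ> f)" "(h \<circ> f) ` A \<subseteq> {0..1}"
      using AX by (auto simp: continuous_map_in_subtopology)
    then obtain g where g: "continuous_map X euclideanreal g" "\<And>x. x \<in> A \<Longrightarrow> g x = (h \<circ> f) x"
      "g ` topspace X \<subseteq> {0..1}"
      using Tietze_extension_closed_real_interval[OF nor A, of "h \<circ> f" 0 1] by auto
    have "continuous_map X (top_of_set {0..1}) (restrict g (topspace X))"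
      by (rule continuous_map_eq[of _ _ g]) (use g in \<open>auto simp: continuous_map_in_subtopology\<close>)
    then have "restrict g (topspace X) \<in> unit_functions X" by (simp add: unit_functions_def)
    moreover have "\<forall>x\<in>A. restrict g (topspace X) x = h (f x)" using g(2) AX by auto
    ultimately show ?thesis by blast
  qed
  then obtain k where k: "\<And>h. h \<in> unit_functions Y \<Longrightarrow> k h \<in> unit_functions X"
    "\<And>h x. h \<in> unit_functions Y \<Longrightarrow> x \<in> A \<Longrightarrow> k h x = h (f x)" by metis
  define G :: "(('a \<Rightarrow> real) \<Rightarrow> real) \<Rightarrow> ('b \<Rightarrow> real) \<Rightarrow> real"
    where "G = (\<lambda>w. \<lambda>h\<in>unit_functions Y. w (k h))"
  have "continuous_map (stone_cech_cube X) (top_of_set {0..1}) (\<lambda>w. w (k h) :: real)" if "h \<in> unit_functions Y" for h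
    unfolding stone_cech_cube_def by (rule continuous_map_product_projection[OF k(1)[OF that]])
  then have "continuous_map (stone_cech_cube X) (stone_cech_cube Y) G"
    unfolding stone_cech_cube_def[of Y] by (auto simp: continuous_map_componentwise G_def)
  then have contG: "continuous_map (stone_cech X) (stone_cech_cube Y) G"
    unfolding stone_cech_def by (rule continuous_map_from_subtopology)
  have Gj: "G (stone_cech_map X x) = stone_cech_map Y (f x)" if "x \<in> A" for x
    using that k by (auto simp: G_def stone_cech_map_def fun_eq_iff)
  let ?I = "stone_cech_map Y ` topspace Y"
  \<comment> \<open>The embedded copy of \<open>Y\<close> is closed, so \<open>G\<close>, which maps
    the image of \<open>A\<close> into it, maps the closure of that image into it as well. There the
    embedding can be inverted.\<close>
  have "compactin (stone_cech_cube Y) ?I"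
    using Y(1) continuous_map_stone_cech_cube image_compactin compact_space_def by blast
  then have "closedin (stone_cech_cube Y) ?I"
    by (simp add: Hausdorff_space_stone_cech_cube compactin_imp_closedin)
  then have "stone_cech_cube Y closure_of (G ` stone_cech_map X ` A) \<subseteq> ?I"
    using Gj fA by (intro closure_of_minimal) auto
  then have "G ` ?B \<subseteq> ?I"
    using continuous_map_image_closure_subset[OF contG] by blast
  then have GB: "continuous_map (subtopology (stone_cech X) ?B) (subtopology (stone_cech_cube Y) ?I) G"
    using contG by (auto simp: continuous_map_in_subtopology continuous_map_from_subtopology)
  obtain d where d: "homeomorphic_maps Y (subtopology (stone_cech_cube Y) ?I) (stone_cech_map Y) d"
    using embedding_map_stone_cech_cube[OF Y] unfolding embedding_map_def homeomorphic_map_maps by blast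
  have "continuous_map (subtopology (stone_cech X) ?B) Y (d \<circ> G)"
    using d GB by (auto simp: homeomorphic_maps_def intro: continuous_map_compose)
  moreover have "(d \<circ> G) (stone_cech_map X x) = f x" if "x \<in> A" for x
    using d Gj that fA by (simp add: homeomorphic_maps_def)
  ultimately show ?thesis by (intro exI[of _ "d \<circ> G"]) simp
qed

section \<open>The two implications for a single map\<close>

lemma tau_cm_if_tau_stone_cech:
  assumes nor: "normal_space X" and K: "Hausdorff_space K" and tau: "tau (stone_cech X) K L i"
  shows "tau_cm X K L i"
  unfolding tau_cm_def
proof (intro allI impI, elim conjE)
  fix A f assume A: "closedin X A" and f: "compact_map (subtopology X A) K f"
  let ?j = "stone_cech_map X" and ?B = "stone_cech X closure_of (stone_cech_map X ` A)"
  obtain S where S: "compactin K S" "f ` topspace (subtopology X A) \<subseteq> S" and contf: "continuous_map (subtopology X A) K f"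
    using f by (auto simp: compact_map_def)
  have AX: "A \<subseteq> topspace X" using closedin_subset[OF A] .
  have "continuous_map (subtopology X A) (subtopology K S) f"
    using S contf by (auto simp: continuous_map_in_subtopology)
  moreover have "compact_space (subtopology K S)" "Hausdorff_space (subtopology K S)"
    using S(1) K by (simp_all add: compactin_subspace Hausdorff_space_subtopology)
  ultimately have "\<exists>g. continuous_map (subtopology (stone_cech X) ?B) (subtopology K S) g \<and>
      (\<forall>x\<in>A. g (?j x) = f x)"
    by (rule stone_cech_extension[OF nor A])
  then obtain g where "continuous_map (subtopology (stone_cech X) ?B) (subtopology K S) g \<and>
      (\<forall>x\<in>A. g (?j x) = f x)" ..
  then have g: "continuous_map (subtopology (stone_cech X) ?B) (subtopology K S) g"
    "\<And>x. x \<in> A \<Longrightarrow> g (?j x) = f x" by simp_all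
  then have "continuous_map (subtopology (stone_cech X) ?B) K g"
    by (simp add: continuous_map_in_subtopology)
  then have "\<exists>F. continuous_map (stone_cech X) L F \<and> (\<forall>w\<in>?B. F w = i (g w))"
    using tau closedin_closure_of unfolding tau_def by simp
  then obtain F where F: "continuous_map (stone_cech X) L F" "\<And>w. w \<in> ?B \<Longrightarrow> F w = i (g w)"
    by auto
  have jX: "?j ` topspace X \<subseteq> topspace (stone_cech X)"
    using continuous_map_image_subset_topspace[OF continuous_map_stone_cech_map] .
  \<comment> \<open>The restriction of \<open>F\<close> to \<open>X\<close> is a compact map because
    \<beta>(X) itself is compact.\<close>
  have "compactin L (F ` topspace (stone_cech X))"
    using F(1) compact_space_stone_cech image_compactin compact_space_def by blast
  moreover have "(F \<circ> ?j) ` topspace X \<subseteq> F ` topspace (stone_cech X)" using jX by auto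
  ultimately have "compact_map X L (F \<circ> ?j)"
    unfolding compact_map_def using continuous_map_compose[OF continuous_map_stone_cech_map F(1)] by blast
  moreover have "(F \<circ> ?j) x = i (f x)" if "x \<in> A" for x
  proof -
    have "?j ` A \<subseteq> ?B" using jX AX by (intro closure_of_subset) auto
    then show ?thesis using that F(2)[of "?j x"] g(2) by auto
  qed
  ultimately show "\<exists>F. compact_map X L F \<and> (\<forall>x\<in>A. F x = i (f x))" by blast
qed

text \<open>The hypothesis \<open>ext\<close> isolates what the cell structure of \<open>K\<close>
  has to supply. Its compact set \<open>Y\<close> makes the composite of \<open>g\<close> with the
  map from \<open>X\<close> a compact map.\<close>

lemma tau_stone_cech_if_tau_cm:
  assumes nor: "normal_space X" and i: "continuous_map K L i" and L: "Hausdorff_space L"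
    and tau: "tau_cm X K L i"
    and ext: "\<And>B f. closedin (stone_cech X) B \<Longrightarrow> continuous_map (subtopology (stone_cech X) B) K f \<Longrightarrow>
      \<exists>W Y g. openin (stone_cech X) W \<and> B \<subseteq> W \<and> compactin K Y \<and>
        continuous_map (subtopology (stone_cech X) W) (subtopology K Y) g \<and> (\<forall>x\<in>B. g x = f x)"
  shows "tau (stone_cech X) K L i"
  unfolding tau_def
proof (intro allI impI, elim conjE)
  fix B f assume B: "closedin (stone_cech X) B" and f: "continuous_map (subtopology (stone_cech X) B) K f"
  let ?Z = "stone_cech X" and ?j = "stone_cech_map X"
  obtain W Y g where W: "openin ?Z W" "B \<subseteq> W" and Y: "compactin K Y"
    and g: "continuous_map (subtopology ?Z W) (subtopology K Y) g" "\<And>x. x \<in> B \<Longrightarrow> g x = f x"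
    using ext[OF B f] by auto
  \<comment> \<open>Two nested neighbourhoods are needed: the closed \<open>N\<close> has a closed
    preimage in \<open>X\<close>, as the hypothesis requires, and the open \<open>U\<close> inside
    it allows the density argument at points of \<open>B\<close>.\<close>
  obtain U where U: "openin ?Z U" "B \<subseteq> U" "?Z closure_of U \<subseteq> W"
    using normal_space_stone_cech[of X] B W unfolding normal_space_alt by meson
  define N where "N = ?Z closure_of U"
  have N: "closedin ?Z N" "U \<subseteq> N" "N \<subseteq> W"
    using U closure_of_subset[OF openin_subset[OF U(1)]] by (auto simp: N_def)
  have gN: "continuous_map (subtopology ?Z N) K g" "g ` N \<subseteq> Y"
  proof -
    have "continuous_map (subtopology ?Z W) K g"
      using g(1) by (simp add: continuous_map_in_subtopology)
    then show "continuous_map (subtopology ?Z N) K g"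
      by (rule continuous_map_from_subtopology_mono[OF _ N(3)])
    show "g ` N \<subseteq> Y"
      using g(1) N closedin_subset[OF N(1)] by (auto simp: continuous_map_in_subtopology)
  qed
  define A where "A = {x \<in> topspace X. ?j x \<in> N}"
  have A: "closedin X A"
    unfolding A_def by (rule closedin_continuous_map_preimage[OF continuous_map_stone_cech_map N(1)])
  have "continuous_map (subtopology X A) (subtopology ?Z N) ?j"
    using continuous_map_from_subtopology[OF continuous_map_stone_cech_map, of X A]
    by (auto simp: continuous_map_in_subtopology A_def)
  then have "compact_map (subtopology X A) K (g \<circ> ?j)"
    unfolding compact_map_def using Y gN continuous_map_compose[OF _ gN(1)]
    by (intro conjI exI[of _ Y]) (auto simp: A_def)
  from tau[unfolded tau_cm_def, rule_format, OF conjI[OF A this]]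
  obtain F where F: "compact_map X L F" "\<And>x. x \<in> A \<Longrightarrow> F x = i (g (?j x))"
    by auto
  then obtain S where S: "compactin L S" "F ` topspace X \<subseteq> S" "continuous_map X L F"
    by (auto simp: compact_map_def)
  then have "continuous_map (subtopology X (topspace X)) (subtopology L S) F"
    by (auto simp: continuous_map_in_subtopology)
  moreover have "compact_space (subtopology L S)" "Hausdorff_space (subtopology L S)"
    using S(1) L by (simp_all add: compactin_subspace Hausdorff_space_subtopology)
  ultimately have "\<exists>H. continuous_map (subtopology ?Z (?Z closure_of (?j ` topspace X))) (subtopology L S) H \<and>
      (\<forall>x\<in>topspace X. H (?j x) = F x)"
    by (rule stone_cech_extension[OF nor closedin_topspace])
  then obtain H where "continuous_map (subtopology ?Z (?Z closure_of (?j ` topspace X))) (subtopology L S) H \<and>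
      (\<forall>x\<in>topspace X. H (?j x) = F x)" ..
  then have H: "continuous_map (subtopology ?Z (?Z closure_of (?j ` topspace X))) (subtopology L S) H"
    "\<And>x. x \<in> topspace X \<Longrightarrow> H (?j x) = F x" by simp_all
  have contH: "continuous_map ?Z L H"
    using H(1) by (simp add: dense_stone_cech_map continuous_map_in_subtopology)
  have "H w = i (f w)" if "w \<in> B" for w
  proof -
    have wU: "w \<in> U" "w \<in> topspace ?Z" using that U(2) openin_subset[OF U(1)] by auto
    \<comment> \<open>Since \<open>U\<close> is open and the image of \<open>X\<close> is dense,
      \<open>w\<close> is a limit of image points in \<open>U\<close>, and these come from
      \<open>A\<close>.\<close>
    then have "w \<in> ?Z closure_of (U \<inter> ?j ` topspace X)"
      using openin_Int_closure_of_subset[OF U(1), of "?j ` topspace X"] dense_stone_cech_map by auto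
    moreover have "U \<inter> ?j ` topspace X \<subseteq> N \<inter> ?j ` A"
      using N(2) by (auto simp: A_def)
    ultimately have "w \<in> ?Z closure_of (N \<inter> ?j ` A)" using closure_of_mono by blast
    then have "w \<in> subtopology ?Z N closure_of (?j ` A)"
      using wU N(2) by (auto simp: closure_of_subtopology A_def Int_commute inf.absorb_iff2 image_subset_iff)
    \<comment> \<open>Both maps are continuous on \<open>N\<close> and agree on the image of
      \<open>A\<close>; as \<open>L\<close> is Hausdorff, they agree on its closure in
      \<open>N\<close>.\<close>
    then have "H w = (i \<circ> g) w"
    proof (rule forall_in_closure_of_eq[OF _ L])
      show "continuous_map (subtopology ?Z N) L H" using contH by (rule continuous_map_from_subtopology)
      show "continuous_map (subtopology ?Z N) L (i \<circ> g)" using gN(1) i by (rule continuous_map_compose)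
    qed (use F(2) H(2) in \<open>auto simp: A_def\<close>)
    then show ?thesis using g(2) that by simp
  qed
  then show "\<exists>F. continuous_map ?Z L F \<and> (\<forall>x\<in>B. F x = i (f x))" using contH by blast
qed

subsection \<open>Attaching a cell to a neighbourhood retract\<close>

lemma continuous_map_sequence_iff:
  fixes f :: "'a \<Rightarrow> nat \<Rightarrow> real"
  shows "continuous_map X euclidean f \<longleftrightarrow> (\<forall>i. continuous_map X euclideanreal (\<lambda>x. f x i))"
  using continuous_map_componentwise_UNIV[of X "\<lambda>_. euclideanreal" f]
  unfolding euclidean_product_topology .

text \<open>In the product topology continuity is coordinatewise, so the extensions of the separate
  coordinates can be chosen independently.\<close>

lemma Tietze_extension_sequence:
  fixes f :: "'a \<Rightarrow> nat \<Rightarrow> real"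
  assumes "normal_space X" "closedin X B" "continuous_map (subtopology X B) euclidean f"
  obtains g where "continuous_map X euclidean g" "\<And>x. x \<in> B \<Longrightarrow> g x = f x"
proof -
  have "continuous_map (subtopology X B) euclideanreal (\<lambda>x. f x i)" for i
    using assms(3) by (simp add: continuous_map_sequence_iff)
  then have "\<forall>i. \<exists>g. continuous_map X euclideanreal g \<and> (\<forall>x\<in>B. g x = f x i)"
    using assms(1,2) unfolding normal_space_iff_Tietze by simp
  then obtain g where g: "\<And>i. continuous_map X euclideanreal (g i)" "\<And>i x. x \<in> B \<Longrightarrow> g i x = f x i"
    by metis
  have "continuous_map X euclidean (\<lambda>x i. g i x)"
    using g(1) by (simp add: continuous_map_sequence_iff)
  moreover have "(\<lambda>i. g i x) = f x" if "x \<in> B" for x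
    using g(2) that by auto
  ultimately show ?thesis using that[of "\<lambda>x i. g i x"] by simp
qed

definition nbhd_retract :: "'a::topological_space set \<Rightarrow> bool" where
  "nbhd_retract S \<longleftrightarrow> (\<exists>V r. open V \<and> S \<subseteq> V \<and> continuous_on V r \<and> r ` V \<subseteq> S \<and> (\<forall>x\<in>S. r x = x))"

text \<open>Tietze extends \<open>f\<close> as a map into the ambient space; on the preimage of the
  neighbourhood \<open>V\<close> the retraction brings the values back into
  \<open>S\<close>.\<close>

lemma nbhd_retract_extend:
  fixes S :: "(nat \<Rightarrow> real) set"
  assumes "nbhd_retract S" "normal_space X" "closedin X B"
    and f: "continuous_map (subtopology X B) (top_of_set S) f"
  obtains W g where "openin X W" "B \<subseteq> W" "continuous_map (subtopology X W) (top_of_set S) g"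
    "\<And>x. x \<in> B \<Longrightarrow> g x = f x"
proof -
  obtain V r where V: "open V" "S \<subseteq> V" "continuous_on V r" "r ` V \<subseteq> S" "\<And>x. x \<in> S \<Longrightarrow> r x = x"
    using assms(1) unfolding nbhd_retract_def by metis
  have fS: "f x \<in> S" if "x \<in> B" for x
    using f that closedin_subset[OF assms(3)] by (fastforce simp: continuous_map_in_subtopology)
  obtain g where g: "continuous_map X euclidean g" "\<And>x. x \<in> B \<Longrightarrow> g x = f x"
    using Tietze_extension_sequence[OF assms(2,3), of f] f
    by (auto simp: continuous_map_in_subtopology)
  define W where "W = {x \<in> topspace X. g x \<in> V}"
  have "openin X W"
    using openin_continuous_map_preimage[OF g(1)] V(1) unfolding W_def by simp
  moreover have "B \<subseteq> W"
    using closedin_subset[OF assms(3)] fS V(2) g(2) unfolding W_def by auto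
  moreover have "continuous_map (subtopology X W) (top_of_set S) (r \<circ> g)"
  proof (rule continuous_map_compose)
    show "continuous_map (subtopology X W) (top_of_set V) g"
      using g(1) by (auto simp: continuous_map_in_subtopology continuous_map_from_subtopology W_def)
    show "continuous_map (top_of_set V) (top_of_set S) r"
      using V by (auto simp: continuous_map_in_subtopology)
  qed
  moreover have "(r \<circ> g) x = f x" if "x \<in> B" for x
    using g(2) V(5) fS that by simp
  ultimately show ?thesis by (rule that)
qed

section \<open>Discs in the space of sequences and the radial projection onto them\<close>

abbreviation nrm :: "nat \<Rightarrow> (nat \<Rightarrow> real) \<Rightarrow> real" where
  "nrm n x \<equiv> L2_set x {..<n}"

definition disc :: "nat \<Rightarrow> (nat \<Rightarrow> real) set" where
  "disc n = {x. (\<forall>i\<ge>n. x i = 0) \<and> nrm n x \<le> 1}"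

text \<open>A retraction of the whole sequence space onto \<open>disc n\<close>: later coordinates
  are cut off, and the divisor \<open>max 1\<close> leaves points of the disc unchanged without a
  case distinction.\<close>

definition radial :: "nat \<Rightarrow> (nat \<Rightarrow> real) \<Rightarrow> nat \<Rightarrow> real" where
  "radial n x = (\<lambda>i. if i < n then x i / max 1 (nrm n x) else 0)"

lemma continuous_on_nrm [continuous_intros]:
  assumes "continuous_on S f"
  shows "continuous_on S (\<lambda>x. nrm n (f x))"
  unfolding L2_set_def
  by (intro continuous_intros continuous_on_product_then_coordinatewise[OF assms])

lemma continuous_on_radial [continuous_intros]:
  assumes "continuous_on S f"
  shows "continuous_on S (\<lambda>x. radial n (f x))"
proof (rule continuous_on_coordinatewise_then_product)
  fix i
  have "continuous_on S (\<lambda>x. f x i / max 1 (nrm n (f x)))"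
    by (intro continuous_on_divide continuous_on_max continuous_on_const continuous_on_nrm assms
        continuous_on_product_then_coordinatewise[OF assms]) (simp add: max_def)
  then show "continuous_on S (\<lambda>x. radial n (f x) i)"
    by (cases "i < n") (simp_all add: radial_def)
qed

lemma nrm_radial: "nrm n (radial n x) = nrm n x / max 1 (nrm n x)"
proof -
  have "nrm n (radial n x) = nrm n (\<lambda>i. inverse (max 1 (nrm n x)) * x i)"
    by (rule L2_set_cong) (auto simp: radial_def divide_inverse)
  also have "\<dots> = inverse (max 1 (nrm n x)) * nrm n x"
    by (rule L2_set_right_distrib[symmetric]) simp
  finally show ?thesis by (simp only: divide_inverse mult.commute)
qed

lemma radial_in_disc: "radial n x \<in> disc n"
proof -
  have "nrm n (radial n x) \<le> 1"
    unfolding nrm_radial by (simp add: max_def)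
  moreover have "radial n x i = 0" if "n \<le> i" for i
    using that by (simp add: radial_def)
  ultimately show ?thesis by (simp add: disc_def)
qed

lemma radial_id:
  assumes "x \<in> disc n"
  shows "radial n x = x"
proof
  fix i
  have "max 1 (nrm n x) = 1" "n \<le> i \<Longrightarrow> x i = 0" using assms by (simp_all add: disc_def)
  then show "radial n x i = x i" by (simp add: radial_def)
qed

lemma nrm_radial_eq_1: "1 \<le> nrm n x \<Longrightarrow> nrm n (radial n x) = 1"
  unfolding nrm_radial by (simp add: max_def)

lemma nrm_scale: "0 \<le> c \<Longrightarrow> nrm n (\<lambda>i. c * x i) = c * nrm n x"
  by (rule L2_set_right_distrib[symmetric])

text \<open>Stretching followed by projection fixes the boundary sphere. This is what makes the
  pushed maps below continuous where the cell meets the old set.\<close>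

lemma radial_scale_boundary:
  assumes "x \<in> disc n" "nrm n x = 1" "1 \<le> c"
  shows "radial n (\<lambda>i. c * x i) = x"
proof
  fix i
  have "max 1 (nrm n (\<lambda>i. c * x i)) = c"
    using assms(3) by (subst nrm_scale) (simp_all add: assms(2))
  moreover have "n \<le> i \<Longrightarrow> x i = 0" using assms(1) by (simp add: disc_def)
  ultimately show "radial n (\<lambda>i. c * x i) i = x i" using assms(3) by (simp add: radial_def)
qed

text \<open>A closed subset of a countable power of [-1,1], which is compact by Tychonoff.\<close>

lemma compact_disc: "compact (disc n)"
proof -
  have "compactin (product_topology (\<lambda>i. euclideanreal) UNIV) (PiE UNIV (\<lambda>i::nat. {-1..1::real}))"
    by (subst compactin_PiE) auto
  then have "compact (PiE UNIV (\<lambda>i::nat. {-1..1::real}))"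
    by (simp add: euclidean_product_topology)
  moreover have "disc n = PiE UNIV (\<lambda>i::nat. {-1..1::real}) \<inter> disc n"
  proof -
    have "\<bar>x i\<bar> \<le> 1" if "x \<in> disc n" for x i
    proof (cases "i < n")
      case True
      then have "\<bar>x i\<bar> \<le> nrm n x"
        using member_le_L2_set[of "{..<n}" i "\<lambda>i. \<bar>x i\<bar>"] by (simp add: L2_set_def)
      with that show ?thesis by (auto simp: disc_def)
    qed (use that in \<open>auto simp: disc_def\<close>)
    then show ?thesis by (fastforce simp: abs_le_iff)
  qed
  moreover have "closed (disc n)"
  proof -
    have "disc n = (\<Inter>i\<in>{n..}. {x. x i = 0}) \<inter> {x. nrm n x \<le> 1}"
      by (auto simp: disc_def)
    moreover have "closed {x::nat\<Rightarrow>real. x i = 0}" for i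
      by (intro closed_Collect_eq continuous_on_product_coordinates continuous_on_const)
    moreover have "closed {x. nrm n x \<le> 1}"
      by (intro closed_Collect_le continuous_intros)
    ultimately show ?thesis by (simp only:) (intro closed_Int closed_INT ballI)
  qed
  ultimately show ?thesis by (metis compact_Int_closed)
qed

lemma closed_disc_eq: "closed_disc n = top_of_set (disc n)"
proof -
  have "disc n = {x. \<forall>i\<ge>n. x i = 0} \<inter> {x. (\<Sum>i<n. (x i)\<^sup>2) \<le> 1}"
    by (auto simp: disc_def L2_set_def)
  then show ?thesis
    by (simp add: closed_disc_def Euclidean_space_def subtopology_subtopology euclidean_product_topology)
qed

lemma open_disc_eq: "open_disc n = {x \<in> disc n. nrm n x < 1}"
  by (auto simp: open_disc_def disc_def topspace_Euclidean_space L2_set_def)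
lemma disc_boundary_eq: "disc_boundary n = {x \<in> disc n. nrm n x = 1}"
  by (auto simp: disc_boundary_def disc_def topspace_Euclidean_space L2_set_def)

text \<open>
  The chart \<open>\<psi>\<close> of the cell is extended to \<open>\<xi>\<close> off \<open>T\<close>. Near the cell, where \<open>u\<close> is small, the
  retraction is \<open>\<Psi> (radial n ((1 + 2 u) \<xi>))\<close>: it fixes the cell, where \<open>u = 0\<close>, and it has been pushed into
  \<open>T\<close> at the points with \<open>u = 1/2\<close> that lie outside half of the disc. From there it is continued by
  the extension property of \<open>T\<close>. The points with \<open>u = 1/2\<close> inside half of the disc form a closed set
  \<open>K\<close> away from \<open>S\<close>, which is discarded.
\<close>

lemma nbhd_retract_attach_cell:
  fixes S T :: "(nat \<Rightarrow> real) set"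
  assumes "closed S" "closed T" and TS: "T \<subseteq> S" and nrT: "nbhd_retract T"
    and cont\<Psi>: "continuous_on (disc n) \<Psi>" and \<Psi>S: "\<Psi> ` disc n \<subseteq> S"
    and \<Psi>T: "\<And>x. x \<in> disc n \<Longrightarrow> \<Psi> x \<in> T \<longleftrightarrow> nrm n x = 1"
    and cont\<psi>: "continuous_on (S - T) \<psi>" and \<psi>disc: "\<psi> ` (S - T) \<subseteq> disc n"
    and \<Psi>\<psi>: "\<And>z. z \<in> S - T \<Longrightarrow> \<Psi> (\<psi> z) = z"
  shows "nbhd_retract S"
proof -
  have op: "open (-T)" using \<open>closed T\<close> by auto
  have nor: "normal_space (top_of_set (- T))"
    by (simp add: metrizable_imp_normal_space metrizable_space_euclidean metrizable_space_subtopology)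
  have cl: "closedin (top_of_set (-T)) (S - T)"
    using \<open>closed S\<close> by (metis Diff_eq closedin_closed_Int inf_commute)
  \<comment> \<open>The chart is defined on a relatively closed subset of the complement of
    \<open>T\<close>, which is metrizable and hence normal. The extension is a sequence of arbitrary
    size; \<open>radial\<close> returns it to the disc.\<close>
  obtain \<xi>0 where \<xi>0: "continuous_on (-T) \<xi>0" "\<And>z. z \<in> S - T \<Longrightarrow> \<xi>0 z = \<psi> z"
    using Tietze_extension_sequence[OF nor cl, of \<psi>] cont\<psi> TS
    by (auto simp: subtopology_subtopology Int_absorb1 Diff_eq)
  define \<xi> where "\<xi> = (\<lambda>z. radial n (\<xi>0 z))"
  have \<xi>: "continuous_on (-T) \<xi>" "\<And>z. \<xi> z \<in> disc n" "\<And>z. z \<in> S - T \<Longrightarrow> \<xi> z = \<psi> z"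
    using \<xi>0 \<psi>disc by (auto simp: \<xi>_def radial_in_disc image_subset_iff radial_id intro!: continuous_intros)
  show ?thesis
  \<comment> \<open>The empty case is separate because \<open>infdist\<close> to the empty set is 0,
    which would make \<open>W\<close> below empty. Here \<xi> is defined everywhere and \<Psi> after
    \<xi> is already a retraction.\<close>
  proof (cases "T = {}")
    case True
    have "continuous_on UNIV (\<lambda>z. \<Psi> (\<xi> z))"
      using True \<xi> by (intro continuous_on_compose2[OF cont\<Psi>]) auto
    then show ?thesis
      unfolding nbhd_retract_def using True \<xi> \<Psi>S \<Psi>\<psi>
      by (intro exI[of _ UNIV] exI[of _ "\<lambda>z. \<Psi> (\<xi> z)"]) (auto simp: image_subset_iff)
  next
    case False
    \<comment> \<open>On \<open>W\<close> the map \<Psi> after \<xi> moves a point by less than its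
      distance to \<open>T\<close>, so it tends to the identity at \<open>T\<close>. Points of
      \<open>S - T\<close> are not moved at all.\<close>
    define W where "W = {z \<in> -T. dist (\<Psi> (\<xi> z)) z < infdist z T}"
    have cont\<Psi>\<xi>: "continuous_on (-T) (\<lambda>z. \<Psi> (\<xi> z))"
      using \<xi> by (intro continuous_on_compose2[OF cont\<Psi>]) auto
    have "open W"
    proof -
      have "W = (-T) \<inter> (\<lambda>z. infdist z T - dist (\<Psi> (\<xi> z)) z) -` {0<..}"
        by (auto simp: W_def)
      then show ?thesis
        using op cont\<Psi>\<xi> by (auto intro!: continuous_open_preimage continuous_intros)
    qed
    have SW: "S - T \<subseteq> W"
      using \<xi>(3) \<Psi>\<psi> infdist_pos_not_in_closed[OF \<open>closed T\<close> False] by (auto simp: W_def)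
    have "closedin (top_of_set (-T)) (-T - W)"
      using \<open>open W\<close> by (metis Diff_eq closedin_closed_Int closed_Compl)
    \<comment> \<open>The function vanishes on the open cell and is 1 off \<open>W\<close>; hence
      the set \<open>P\<close> where it is at most 1/2 lies in \<open>W\<close>, where the
      displacement is controlled.\<close>
    then obtain u :: "(nat \<Rightarrow> real) \<Rightarrow> real" where u: "continuous_map (top_of_set (-T)) (top_of_set {0..1}) u"
       "u ` (S - T) \<subseteq> {0}" "u ` (-T - W) \<subseteq> {1}"
      using Urysohn_lemma[OF nor cl, of "-T - W" 0 1] SW by (auto simp: disjnt_def)
    have contu: "continuous_on (-T) u"
      using u(1) by (simp add: continuous_map_in_subtopology)
    have u0: "u z = 0" if "z \<in> S - T" for z using u(2) that by auto
    have u1: "z \<in> W" if "z \<notin> T" "u z < 1" for z using u(3) that by force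
    define P where "P = {z \<in> -T. u z \<le> 1/2}"
    \<comment> \<open>The factor stays a parameter because two instances are needed: the pushing map
      \<open>R\<close>, and the constant factor 1, which gives \<Psi> after \<xi> continued by the
      identity on \<open>T\<close>.\<close>
    define F where "F = (\<lambda>c z. if z \<in> T then z else \<Psi> (radial n (\<lambda>i. c z * \<xi> z i)))"
    \<comment> \<open>Continuity at \<open>b \<in> T\<close>: the points of the disc that some factor in \<open>{1..2}\<close> moves out of \<open>U\<close> form
      a compact set, and the image of this set avoids \<open>b\<close> since boundary points are not moved.\<close>
    have contF: "continuous_on (P \<union> T) (F c)"
      if c: "continuous_on (-T) c" "\<And>z. z \<notin> T \<Longrightarrow> 1 \<le> c z \<and> c z \<le> (2::real)" for c
      unfolding continuous_on_eq_continuous_within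
    proof
      fix b assume b: "b \<in> P \<union> T"
      show "continuous (at b within P \<union> T) (F c)"
      proof (cases "b \<in> T")
        case False
        have "continuous_on (-T) (\<lambda>z. radial n (\<lambda>i. c z * \<xi> z i))"
          by (intro continuous_on_radial continuous_on_coordinatewise_then_product continuous_on_mult c(1)
              continuous_on_product_then_coordinatewise[OF \<xi>(1)])
        then have "continuous_on (-T) (\<lambda>z. \<Psi> (radial n (\<lambda>i. c z * \<xi> z i)))"
          using radial_in_disc by (intro continuous_on_compose2[OF cont\<Psi>]) auto
        then have "continuous_on (-T) (F c)"
          by (rule continuous_on_eq) (auto simp: F_def)
        then show ?thesis
          using op False by (metis ComplI continuous_at_imp_continuous_at_within continuous_on_eq_continuous_at)
      next
        case True
        show ?thesis
          unfolding continuous_within_topological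
        proof (intro allI impI)
          fix U assume U: "open U" "F c b \<in> U"
          define B where "B = {xs \<in> disc n \<times> {1..2}. \<Psi> (radial n (\<lambda>i. snd xs * fst xs i)) \<notin> U}"
          have "continuous_on (disc n \<times> {1..2}) (\<lambda>xs. \<Psi> (radial n (\<lambda>i. snd xs * fst xs i)))"
            by (intro continuous_on_compose2[OF cont\<Psi>] continuous_on_radial continuous_on_mult
                  continuous_on_coordinatewise_then_product continuous_on_snd continuous_on_id
                  continuous_on_product_then_coordinatewise[OF continuous_on_fst])
               (auto simp: radial_in_disc)
          then have "compact ((disc n \<times> {1..2}) \<inter> (\<lambda>xs. \<Psi> (radial n (\<lambda>i. snd xs * fst xs i))) -` (-U))"
            using U(1) compact_disc
            by (intro closedin_compact[OF compact_Times continuous_closedin_preimage]) auto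
          moreover have "B = (disc n \<times> {1..2}) \<inter> (\<lambda>xs. \<Psi> (radial n (\<lambda>i. snd xs * fst xs i))) -` (-U)"
            by (auto simp: B_def)
          ultimately have "compact B" by simp
          then have "compact (\<Psi> ` fst ` B)"
            by (intro compact_continuous_image continuous_on_subset[OF cont\<Psi>] continuous_intros) (auto simp: B_def)
          moreover have "b \<notin> \<Psi> ` fst ` B"
          proof
            assume "b \<in> \<Psi> ` fst ` B"
            then obtain x s where x: "b = \<Psi> x" "x \<in> disc n" "1 \<le> s" "\<Psi> (radial n (\<lambda>i. s * x i)) \<notin> U"
              unfolding B_def by auto
            then have "nrm n x = 1" using \<Psi>T True by auto
            with x U(2) True show False
              by (simp add: radial_scale_boundary F_def)
          qed
          ultimately have "open (U - \<Psi> ` fst ` B)" "b \<in> U - \<Psi> ` fst ` B"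
            using U True by (auto simp: F_def intro: open_Diff compact_imp_closed)
          then obtain e where e: "e > 0" "ball b e \<subseteq> U - \<Psi> ` fst ` B"
            using open_contains_ball by metis
          have "F c z \<in> U" if z: "z \<in> P \<union> T" "z \<in> ball b (e/2)" for z
          proof (cases "z \<in> T")
            case True
            then show ?thesis using z(2) e subsetD[OF e(2), of z] by (auto simp: F_def)
          next
            case False
            then have "z \<in> W" using z(1) u1 by (auto simp: P_def)
            then have "dist (\<Psi> (\<xi> z)) z < infdist z T" by (simp add: W_def)
            also have "infdist z T \<le> dist z b" using infdist_le[OF True] .
            also have "\<dots> < e/2" using z(2) by (simp add: dist_commute)
            finally have "dist b (\<Psi> (\<xi> z)) < e"
              using z(2) dist_triangle[of b "\<Psi> (\<xi> z)" z] by (auto simp: dist_commute)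
            then have "\<Psi> (\<xi> z) \<in> ball b e" by simp
            then have nB: "\<Psi> (\<xi> z) \<notin> \<Psi> ` fst ` B" using e(2) by blast
            have "(\<xi> z, c z) \<notin> B"
            proof
              assume "(\<xi> z, c z) \<in> B"
              from imageI[OF imageI[OF this, of fst], of \<Psi>] nB show False by simp
            qed
            then show ?thesis using \<xi>(2) c(2) False by (auto simp: B_def F_def)
          qed
          then show "\<exists>A. open A \<and> b \<in> A \<and> (\<forall>y\<in>P \<union> T. y \<in> A \<longrightarrow> F c y \<in> U)"
            using e(1) by (intro exI[of _ "ball b (e/2)"]) auto
        qed
      qed
    qed
    \<comment> \<open>Truncation keeps the factor within the range [1,2] that \<open>contF\<close>
      asks for, as \<open>u\<close> may reach 1. On \<open>P\<close> it changes nothing, and at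
      \<open>u = 1/2\<close> the factor is exactly 2.\<close>
    define c where "c = (\<lambda>z. max 1 (min 2 (1 + 2 * u z)))"
    define R where "R = F c"
    have contR: "continuous_on (P \<union> T) R"
      unfolding R_def c_def using contu by (intro contF continuous_intros) auto
    have contF1: "continuous_on (P \<union> T) (F (\<lambda>_. 1))"
      by (intro contF continuous_intros) auto
    have less_open: "open {z \<in> -T. u z < 1/2}" and gr_open: "open {z \<in> -T. u z > 1/2}"
      using continuous_open_preimage[OF contu op, of "{..<1/2}"] continuous_open_preimage[OF contu op, of "{1/2<..}"]
      by (auto simp: vimage_def Int_def)
    have PT: "closed (P \<union> T)"
    proof -
      have "P \<union> T = - {z \<in> -T. u z > 1/2}" by (auto simp: P_def)
      with gr_open show ?thesis by auto
    qed
    define Q where "Q = {z \<in> -T. u z \<ge> 1/2}"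
    have QT: "closed (Q \<union> T)"
    proof -
      have "Q \<union> T = - {z \<in> -T. u z < 1/2}" by (auto simp: Q_def)
      with less_open show ?thesis by auto
    qed
    have PQ: "closed ((P \<union> T) \<inter> (Q \<union> T))" using PT QT by auto
    define M where "M = ((P \<union> T) \<inter> (Q \<union> T)) \<inter> R -` T"
    define C where "C = \<Psi> ` {x \<in> disc n. nrm n x \<le> 1/2}"
    \<comment> \<open>The set where \<open>u = 1/2\<close> is closed only relative to the complement
      of \<open>T\<close>. Writing \<open>K\<close> with \<open>F\<close> of factor 1, which is
      continuous across \<open>T\<close>, makes it closed in the whole space.\<close>
    define K where "K = ((P \<union> T) \<inter> (Q \<union> T)) \<inter> F (\<lambda>_. 1) -` C"
    have "closed M"
      unfolding M_def using PQ \<open>closed T\<close> contR by (intro continuous_closed_preimage continuous_on_subset[OF contR]) auto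
    have "compact {x \<in> disc n. nrm n x \<le> 1/2}"
    proof -
      have "closed {x. nrm n x \<le> 1/2}" by (intro closed_Collect_le continuous_intros)
      then have "compact (disc n \<inter> {x. nrm n x \<le> 1/2})" using compact_disc by blast
      then show ?thesis by (simp add: Int_def)
    qed
    then have "closed C"
      unfolding C_def using cont\<Psi> by (intro compact_imp_closed compact_continuous_image continuous_on_subset[OF cont\<Psi>]) auto
    then have "closed K"
      unfolding K_def using PQ contF1 by (intro continuous_closed_preimage continuous_on_subset[OF contF1]) auto
    have CT: "C \<inter> T = {}" using \<Psi>T by (auto simp: C_def)
    have TM: "T \<subseteq> M" by (auto simp: M_def R_def F_def)
    have TK: "T \<inter> K = {}" using CT by (auto simp: K_def F_def)
    have norE: "normal_space (euclidean :: (nat \<Rightarrow> real) topology)"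
      by (simp add: metrizable_imp_normal_space metrizable_space_euclidean)
    have contRM: "continuous_map (subtopology euclidean M) (top_of_set T) R"
      using continuous_on_subset[OF contR, of M] by (auto simp: M_def continuous_map_in_subtopology)
    obtain V p where "openin euclidean V" and MV: "M \<subseteq> V"
      and p: "continuous_map (subtopology euclidean V) (top_of_set T) p" "\<And>z. z \<in> M \<Longrightarrow> p z = R z"
      using nbhd_retract_extend[OF nrT norE _ contRM] \<open>closed M\<close> by (metis closed_closedin)
    then have V: "open V" "M \<subseteq> V" "continuous_on V p" "p ` V \<subseteq> T" "\<And>z. z \<in> M \<Longrightarrow> p z = R z"
      by (auto simp: continuous_map_in_subtopology)
    define W0 where "W0 = {z \<in> -T. u z < 1/2} \<union> (V - K)"
    define r where "r = (\<lambda>z. if z \<in> P \<union> T then R z else p z)"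
    have openW0: "open W0"
      unfolding W0_def using less_open V(1) \<open>closed K\<close> by (intro open_Un open_Diff)
    have SW0: "S \<subseteq> W0"
    proof
      fix z assume "z \<in> S"
      then show "z \<in> W0" using u0[of z] TM TK V(2) by (cases "z \<in> T") (auto simp: W0_def)
    qed
    \<comment> \<open>Off \<open>T\<close> such a point has factor 2, and lying outside
      \<open>K\<close> its \<xi>-value has norm above 1/2. Doubling takes the norm past 1,
      projection lands on the boundary, and so \<open>R\<close> has reached \<open>T\<close>. Hence
      \<open>R\<close> and \<open>p\<close> agree on the overlap.\<close>
    have over: "z \<in> M" if "z \<in> W0" "z \<in> P \<union> T" "z \<in> Q \<union> T" for z
    proof (cases "z \<in> T")
      case False
      then have z: "u z = 1/2" "z \<notin> K" using that by (auto simp: P_def Q_def W0_def)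
      have "\<Psi> (\<xi> z) \<notin> C"
        using z(2) that(2,3) False \<xi>(2)[of z] by (auto simp: K_def F_def radial_id)
      then have "\<not> nrm n (\<xi> z) \<le> 1/2" using \<xi>(2)[of z] unfolding C_def by blast
      then have "nrm n (radial n (\<lambda>i. 2 * \<xi> z i)) = 1"
        by (intro nrm_radial_eq_1) (simp add: nrm_scale)
      then have "R z \<in> T"
        using \<Psi>T[OF radial_in_disc] z(1) False by (simp add: R_def F_def c_def)
      then show ?thesis using that by (auto simp: M_def)
    qed (use TM in auto)
    have WQV: "W0 \<inter> (Q \<union> T) \<subseteq> V"
      using TM V(2) by (auto simp: W0_def Q_def)
    \<comment> \<open>The two pieces are closed in \<open>W0\<close> because \<open>T\<close> has
      been added to each, so continuity on both suffices for the glued map.\<close>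
    have "continuous_on (W0 \<inter> (P \<union> T) \<union> W0 \<inter> (Q \<union> T)) r"
    proof (rule continuous_on_Un_local)
      have "W0 \<inter> (P \<union> T) \<union> W0 \<inter> (Q \<union> T) = W0" by (auto simp: P_def Q_def)
      then show "closedin (top_of_set (W0 \<inter> (P \<union> T) \<union> W0 \<inter> (Q \<union> T))) (W0 \<inter> (P \<union> T))"
        "closedin (top_of_set (W0 \<inter> (P \<union> T) \<union> W0 \<inter> (Q \<union> T))) (W0 \<inter> (Q \<union> T))"
        using closedin_closed_Int[OF PT, of W0] closedin_closed_Int[OF QT, of W0] by simp_all
      have "continuous_on (W0 \<inter> (P \<union> T)) R" using continuous_on_subset[OF contR] by auto
      then show "continuous_on (W0 \<inter> (P \<union> T)) r"
        by (rule continuous_on_eq) (auto simp: r_def)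
      have "continuous_on (W0 \<inter> (Q \<union> T)) p" using continuous_on_subset[OF V(3)] WQV by auto
      then show "continuous_on (W0 \<inter> (Q \<union> T)) r"
        by (rule continuous_on_eq) (use over V(5) in \<open>auto simp: r_def\<close>)
    qed
    moreover have "W0 \<inter> (P \<union> T) \<union> W0 \<inter> (Q \<union> T) = W0" by (auto simp: P_def Q_def)
    ultimately have contr: "continuous_on W0 r" by simp
    have "R z \<in> S" for z
      using TS \<Psi>S radial_in_disc by (auto simp: R_def F_def)
    moreover have "z \<in> V" if "z \<in> W0" "z \<notin> P \<union> T" for z
      using that by (auto simp: W0_def P_def)
    ultimately have "r ` W0 \<subseteq> S"
      using V(4) TS by (auto simp: r_def)
    moreover have "r z = z" if "z \<in> S" for z
    proof (cases "z \<in> T")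
      case False
      with that have z: "z \<in> S - T" by auto
      then have "c z = 1" "z \<in> P" using u0 by (auto simp: c_def P_def)
      with z show ?thesis
        using \<xi>(2)[of z] \<xi>(3)[OF z] \<Psi>\<psi>[OF z] by (simp add: r_def R_def F_def radial_id)
    qed (auto simp: r_def R_def F_def)
    ultimately show ?thesis
      unfolding nbhd_retract_def using openW0 SW0 contr by (intro exI[of _ W0] exI[of _ r]) simp
  qed
qed

subsection \<open>Embedding finite complexes\<close>

text \<open>A continuous injection suffices here: with \<open>Y\<close> compact and the sequence
  space Hausdorff it is an embedding.\<close>

definition embeds_as_nbhd_retract :: "'k topology \<Rightarrow> 'k set \<Rightarrow> bool" where
  "embeds_as_nbhd_retract K Y \<longleftrightarrow> compactin K Y \<and>
     (\<exists>e :: 'k \<Rightarrow> nat \<Rightarrow> real. continuous_map (subtopology K Y) euclidean e \<and> inj_on e Y \<and> nbhd_retract (e ` Y))"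

text \<open>Extending \<open>q\<close> to a neighbourhood with values in \<open>T'\<close> and
  applying \<open>q'\<close> gives a retraction onto \<open>T\<close>. Being a neighbourhood retract
  thus does not depend on the chosen closed embedding.\<close>

lemma nbhd_retract_homeomorphic:
  fixes T T' :: "(nat \<Rightarrow> real) set"
  assumes "nbhd_retract T'" "closed T" "continuous_on T q" "q ` T \<subseteq> T'"
    and "continuous_on T' q'" "q' ` T' \<subseteq> T" "\<And>t. t \<in> T \<Longrightarrow> q' (q t) = t"
  shows "nbhd_retract T"
proof -
  have nor: "normal_space (euclidean :: (nat \<Rightarrow> real) topology)"
    by (simp add: metrizable_imp_normal_space metrizable_space_euclidean)
  have "closedin euclidean T" using assms(2) by simp
  moreover have "continuous_map (subtopology euclidean T) (top_of_set T') q"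
    using assms(3,4) by (auto simp: continuous_map_in_subtopology)
  ultimately obtain W g where W: "openin euclidean W" "T \<subseteq> W"
    "continuous_map (subtopology euclidean W) (top_of_set T') g" and gq: "\<And>t. t \<in> T \<Longrightarrow> g t = q t"
    using nbhd_retract_extend[OF assms(1) nor] by metis
  then have g: "continuous_on W g" "g ` W \<subseteq> T'"
    by (auto simp: continuous_map_in_subtopology)
  have "continuous_on W (\<lambda>w. q' (g w))"
    by (rule continuous_on_compose2[OF assms(5) g])
  moreover have "(\<lambda>w. q' (g w)) ` W \<subseteq> T" using g(2) assms(6) by blast
  moreover have "\<forall>t\<in>T. q' (g t) = t" using gq assms(7) by simp
  ultimately show ?thesis
    unfolding nbhd_retract_def using W(1,2) by (intro exI[of _ W] exI[of _ "\<lambda>w. q' (g w)"]) simp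
qed

lemma compact_subset_inverse:
  fixes e :: "'k \<Rightarrow> nat \<Rightarrow> real"
  assumes "compactin K Y" "continuous_map (subtopology K Y) euclidean e" "inj_on e Y"
  obtains d where "continuous_map (top_of_set (e ` Y)) (subtopology K Y) d"
    "\<And>y. y \<in> Y \<Longrightarrow> d (e y) = y"
proof -
  have Y: "topspace K \<inter> Y = Y"
    using compactin_subset_topspace[OF assms(1)] by auto
  have "embedding_map (subtopology K Y) (euclidean :: (nat \<Rightarrow> real) topology) e"
    using assms by (intro continuous_imp_embedding_map) (simp_all add: compactin_subspace Y)
  then obtain d where "homeomorphic_maps (subtopology K Y) (top_of_set (e ` Y)) e d"
    unfolding embedding_map_def homeomorphic_map_maps by (auto simp: Y)
  then show ?thesis using that[of d] by (simp add: homeomorphic_maps_def Y)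
qed

text \<open>The old embedding extends to the larger compact set but may fail to be injective on the
  new cell; additional coordinates vanishing on \<open>Y\<close> repair this. The inverse of the
  characteristic map then supplies the chart for \<open>nbhd_retract_attach_cell\<close>.\<close>

lemma embeds_as_nbhd_retract_attach_cell:
  fixes K :: "'k topology"
  assumes K: "Hausdorff_space K" and Y: "embeds_as_nbhd_retract K Y"
    and \<Phi>: "continuous_map (closed_disc n) K \<Phi>"
    and homeo: "homeomorphic_map (subtopology (closed_disc n) (open_disc n)) (subtopology K c) \<Phi>"
    and bd: "\<Phi> ` disc_boundary n \<subseteq> Y" and disj: "c \<inter> Y = {}" and cK: "c \<subseteq> topspace K"
  shows "embeds_as_nbhd_retract K (Y \<union> c)"
proof -
  let ?D = "disc n" and ?O = "{x \<in> disc n. nrm n x < 1}"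
  have \<Phi>D: "continuous_map (top_of_set ?D) K \<Phi>" using \<Phi> by (simp add: closed_disc_eq)
  have bdY: "\<Phi> x \<in> Y" if "x \<in> ?D" "nrm n x = 1" for x
    using bd that by (auto simp: disc_boundary_eq)
  have "subtopology (closed_disc n) (open_disc n) = top_of_set ?O"
    by (simp add: closed_disc_eq open_disc_eq subtopology_subtopology Int_absorb1)
  then obtain h where "homeomorphic_maps (top_of_set ?O) (subtopology K c) \<Phi> h"
    using homeo by (auto simp: homeomorphic_map_maps)
  then have conth: "continuous_map (subtopology K c) (top_of_set ?O) h"
    and \<Phi>c: "\<And>x. x \<in> ?O \<Longrightarrow> \<Phi> x \<in> c"
    and h\<Phi>: "\<And>x. x \<in> ?O \<Longrightarrow> h (\<Phi> x) = x" and \<Phi>h: "\<And>y. y \<in> c \<Longrightarrow> \<Phi> (h y) = y"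
    using cK by (auto simp: homeomorphic_maps_def continuous_map_in_subtopology Pi_iff)
  have hO: "h y \<in> ?O" if "y \<in> c" for y
    using conth that cK by (auto simp: continuous_map_in_subtopology Pi_iff)
  define Z where "Z = Y \<union> c"
  have cptY: "compactin K Y" using Y by (simp add: embeds_as_nbhd_retract_def)
  have cpt\<Phi>: "compactin K (\<Phi> ` C)" if "compact C" "C \<subseteq> ?D" for C
  proof (rule image_compactin[OF _ \<Phi>D])
    show "compactin (top_of_set ?D) C" using that by (simp add: compactin_subtopology)
  qed
  have ZD: "Z = Y \<union> \<Phi> ` ?D"
  proof
    show "Z \<subseteq> Y \<union> \<Phi> ` ?D"
    proof
      fix z assume "z \<in> Z"
      then show "z \<in> Y \<union> \<Phi> ` ?D"
      proof (cases "z \<in> Y")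
        case False
        then have "z \<in> c" using \<open>z \<in> Z\<close> by (simp add: Z_def)
        then have "h z \<in> ?D" "\<Phi> (h z) = z" using hO[of z] \<Phi>h[of z] by simp_all
        then show ?thesis by (metis UnI2 imageI)
      qed simp
    qed
    have "\<Phi> x \<in> Z" if "x \<in> ?D" for x
    proof (cases "nrm n x = 1")
      case True then show ?thesis using bdY that by (simp add: Z_def)
    next
      case False
      then have "x \<in> ?O" using that by (simp add: disc_def)
      then show ?thesis using \<Phi>c by (simp add: Z_def)
    qed
    then show "Y \<union> \<Phi> ` ?D \<subseteq> Z" by (auto simp: Z_def)
  qed
  have cptZ: "compactin K Z"
    unfolding ZD using cptY cpt\<Phi>[OF compact_disc] by (intro compactin_Un) auto
  have topZ: "topspace (subtopology K Z) = Z"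
    using compactin_subset_topspace[OF cptZ] by auto
  have HZ: "Hausdorff_space (subtopology K Z)" using K by (rule Hausdorff_space_subtopology)
  have norZ: "normal_space (subtopology K Z)"
    using cptZ HZ by (intro compact_Hausdorff_or_regular_imp_normal_space) (simp_all add: compactin_subspace)
  have clZ: "closedin (subtopology K Z) C" if "compactin K C" "C \<subseteq> Z" for C
    using that HZ by (intro compactin_imp_closedin) (simp_all add: compactin_subtopology)
  obtain e' :: "'k \<Rightarrow> nat \<Rightarrow> real" where e': "continuous_map (subtopology K Y) euclidean e'" "inj_on e' Y"
    "nbhd_retract (e' ` Y)"
    using Y by (auto simp: embeds_as_nbhd_retract_def)
  have "subtopology (subtopology K Z) Y = subtopology K Y"
    by (simp add: subtopology_subtopology Z_def Int_absorb1)
  then obtain e1 where e1: "continuous_map (subtopology K Z) euclidean e1" "\<And>y. y \<in> Y \<Longrightarrow> e1 y = e' y"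
    using Tietze_extension_sequence[OF norZ clZ[OF cptY], of e'] e'(1) by (auto simp: Z_def)
  \<comment> \<open>\<open>\<gamma>\<close> vanishes exactly on the boundary and determines the point of the open disc: coordinate \<open>n\<close>
    gives the radius.\<close>
  define \<gamma> :: "(nat \<Rightarrow> real) \<Rightarrow> nat \<Rightarrow> real"
    where "\<gamma> = (\<lambda>x i. (1 - nrm n x) * (if i < n then x i else 1))"
  define g where "g = (\<lambda>y. if y \<in> Y then (\<lambda>_. 0) else \<gamma> (h y))"
  have cont\<gamma>: "continuous_on UNIV \<gamma>"
    unfolding \<gamma>_def
  proof (rule continuous_on_coordinatewise_then_product)
    fix i
    show "continuous_on UNIV (\<lambda>x. (1 - nrm n x) * (if i < n then x i else 1))"
      by (cases "i < n") (simp_all add: continuous_on_mult continuous_on_diff continuous_on_nrm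
          continuous_on_id continuous_on_product_coordinates)
  qed
  \<comment> \<open>The vanishing of \<gamma> on the boundary sphere makes the two clauses of
    \<open>g\<close> fit together along the characteristic map.\<close>
  have g\<Phi>: "g (\<Phi> x) = \<gamma> x" if x: "x \<in> ?D" for x
  proof (cases "nrm n x = 1")
    case True then show ?thesis using bdY[OF x] by (simp add: g_def \<gamma>_def)
  next
    case False
    then have "x \<in> ?O" using x by (simp add: disc_def)
    then have "\<Phi> x \<notin> Y" "h (\<Phi> x) = x" using \<Phi>c disj h\<Phi> by auto
    then show ?thesis by (simp add: g_def)
  qed
  \<comment> \<open>Continuity is read off from preimages of closed sets: each is a union of at most
    \<open>Y\<close> and the image of a compact part of the disc, hence compact and so
    closed.\<close>
  have contg: "continuous_map (subtopology K Z) euclidean g"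
    unfolding continuous_map_closedin topZ
  proof (intro conjI allI impI)
    fix C :: "(nat \<Rightarrow> real) set" assume "closedin euclidean C"
    then have C: "closed C" by simp
    have eq: "{z \<in> Z. g z \<in> C} = (if (\<lambda>_. 0) \<in> C then Y else {}) \<union> \<Phi> ` (?D \<inter> \<gamma> -` C)"
    proof (intro set_eqI iffI)
      fix z assume z: "z \<in> {z \<in> Z. g z \<in> C}"
      show "z \<in> (if (\<lambda>_. 0) \<in> C then Y else {}) \<union> \<Phi> ` (?D \<inter> \<gamma> -` C)"
      proof (cases "z \<in> Y")
        case True
        then show ?thesis using z by (simp add: g_def)
      next
        case False
        then obtain x where "x \<in> ?D" "z = \<Phi> x" using z ZD by auto
        then show ?thesis using z g\<Phi>[of x] by auto
      qed
    next
      fix z assume "z \<in> (if (\<lambda>_. 0) \<in> C then Y else {}) \<union> \<Phi> ` (?D \<inter> \<gamma> -` C)"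
      then show "z \<in> {z \<in> Z. g z \<in> C}"
      proof
        assume "z \<in> (if (\<lambda>_. 0) \<in> C then Y else {})"
        then show ?thesis by (auto simp: Z_def g_def split: if_splits)
      next
        assume "z \<in> \<Phi> ` (?D \<inter> \<gamma> -` C)"
        then show ?thesis using g\<Phi> ZD by auto
      qed
    qed
    have "compact (?D \<inter> \<gamma> -` C)"
      using closedin_compact[OF compact_disc continuous_closedin_preimage[OF continuous_on_subset[OF cont\<gamma>] C]] by simp
    then have "compactin K {z \<in> Z. g z \<in> C}"
      unfolding eq using cptY by (intro compactin_Un cpt\<Phi>) auto
    then show "closedin (subtopology K Z) {z \<in> Z. g z \<in> C}"
      by (rule clZ) auto
  qed simp_all
  \<comment> \<open>Interleaving pairs two sequences into one, so the ambient type stays the same at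
    every stage.\<close>
  define e where "e = (\<lambda>z i. if even i then e1 z (i div 2) else g z (i div 2))"
  have conte: "continuous_map (subtopology K Z) euclidean e"
    unfolding continuous_map_sequence_iff
  proof
    fix i
    show "continuous_map (subtopology K Z) euclideanreal (\<lambda>z. e z i)"
      using e1(1) contg by (cases "even i") (simp_all add: e_def continuous_map_sequence_iff)
  qed
  have inje: "inj_on e Z"
  proof (rule inj_onI)
    fix y z assume yz: "y \<in> Z" "z \<in> Z" "e y = e z"
    have eq1: "e1 y = e1 z"
    proof
      fix i show "e1 y i = e1 z i" using fun_cong[OF yz(3), of "2 * i"] by (simp add: e_def)
    qed
    have eqg: "g y = g z"
    proof
      fix i show "g y i = g z i" using fun_cong[OF yz(3), of "Suc (2 * i)"] by (simp add: e_def)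
    qed
    \<comment> \<open>Coordinate \<open>n\<close> of \<open>g\<close> is one minus the radius, hence
      positive on the open cell and 0 on \<open>Y\<close>; it tells the two apart.\<close>
    have pos: "g w n > 0" if "w \<in> c" for w
    proof -
      have "w \<notin> Y" "nrm n (h w) < 1" using that disj hO[OF that] by auto
      then show ?thesis by (simp add: g_def \<gamma>_def)
    qed
    have zero: "g w n = 0" if "w \<in> Y" for w using that by (simp add: g_def)
    show "y = z"
    proof (cases "y \<in> Y")
      case True
      then have "z \<in> Y" using yz(2) pos[of z] zero[of y] eqg by (auto simp: Z_def)
      then show ?thesis using True eq1 e1(2) e'(2) by (auto dest: inj_onD)
    next
      case False
      then have yc: "y \<in> c" using yz(1) by (simp add: Z_def)
      then have zc: "z \<in> c" using yz(2) pos[of y] zero[of z] eqg by (auto simp: Z_def)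
      then have "y \<notin> Y" "z \<notin> Y" using yc disj by auto
      then have eq: "\<gamma> (h y) = \<gamma> (h z)" using eqg by (simp add: g_def)
      have nn: "nrm n (h y) = nrm n (h z)" using fun_cong[OF eq, of n] by (simp add: \<gamma>_def)
      have "h y = h z"
      proof
        fix i
        show "h y i = h z i"
        proof (cases "i < n")
          case True
          then show ?thesis using fun_cong[OF eq, of i] nn hO[OF zc] by (simp add: \<gamma>_def)
        next
          case False
          then show ?thesis using hO[OF yc] hO[OF zc] by (simp add: disc_def)
        qed
      qed
      then show ?thesis using \<Phi>h yc zc by metis
    qed
  qed
  obtain d where d: "continuous_map (top_of_set (e ` Z)) (subtopology K Z) d" "\<And>z. z \<in> Z \<Longrightarrow> d (e z) = z"
    using compact_subset_inverse[OF cptZ conte inje] by metis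
  obtain d' where d': "continuous_map (top_of_set (e' ` Y)) (subtopology K Y) d'" "\<And>y. y \<in> Y \<Longrightarrow> d' (e' y) = y"
    using compact_subset_inverse[OF cptY e'(1,2)] by metis
  have YZ: "Y \<subseteq> Z" by (simp add: Z_def)
  have cpt_eZ: "compact (e ` Z)"
    using image_compactin[OF _ conte, of Z] cptZ by (simp add: compactin_subtopology)
  have cpt_eY: "compact (e ` Y)"
    using image_compactin[OF _ conte, of Y] cptY YZ by (simp add: compactin_subtopology)
  have contY: "continuous_map (subtopology K Y) euclidean e"
    by (rule continuous_map_from_subtopology_mono[OF conte YZ])
  have dY: "continuous_map (top_of_set (e ` Y)) (subtopology K Y) d"
  proof -
    have "continuous_map (top_of_set (e ` Y)) K d"
      using d(1) continuous_map_from_subtopology_mono[of euclidean "e ` Z" K d "e ` Y"] YZ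
      by (auto simp: continuous_map_in_subtopology)
    then show ?thesis using d(2) YZ by (auto simp: continuous_map_in_subtopology)
  qed
  \<comment> \<open>The retraction is known for the image under \<open>e'\<close>, whereas
    \<open>e\<close> inserts zeros between those coordinates on \<open>Y\<close>; the property is
    carried over along the two embeddings.\<close>
  have nrY: "nbhd_retract (e ` Y)"
  proof (rule nbhd_retract_homeomorphic[OF e'(3)])
    show "closed (e ` Y)" using cpt_eY by (rule compact_imp_closed)
    show "continuous_on (e ` Y) (e' \<circ> d)"
      using continuous_map_compose[OF dY e'(1)] by simp
    show "(e' \<circ> d) ` e ` Y \<subseteq> e' ` Y" using d(2) YZ by auto
    show "continuous_on (e' ` Y) (e \<circ> d')"
      using continuous_map_compose[OF d'(1) contY] by simp
    show "(e \<circ> d') ` e' ` Y \<subseteq> e ` Y" using d'(2) by auto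
    show "(e \<circ> d') ((e' \<circ> d) t) = t" if "t \<in> e ` Y" for t
      using that d(2) d'(2) YZ by auto
  qed
  have e\<Phi>: "continuous_map (top_of_set ?D) euclidean (e \<circ> \<Phi>)"
  proof (rule continuous_map_compose[OF _ conte])
    show "continuous_map (top_of_set ?D) (subtopology K Z) \<Phi>"
      using \<Phi>D ZD by (auto simp: continuous_map_in_subtopology)
  qed
  have diff: "e ` Z - e ` Y = e ` c"
    using inj_on_image_set_diff[OF inje, of Z Y] YZ disj by (auto simp: Z_def)
  have "nbhd_retract (e ` Z)"
  proof (rule nbhd_retract_attach_cell[of _ "e ` Y" n "e \<circ> \<Phi>" "h \<circ> d"])
    show "closed (e ` Z)" "closed (e ` Y)" using cpt_eZ cpt_eY by (auto intro: compact_imp_closed)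
    show "e ` Y \<subseteq> e ` Z" using YZ by auto
    show "nbhd_retract (e ` Y)" by fact
    show "continuous_on ?D (e \<circ> \<Phi>)" using e\<Phi> by simp
    show "(e \<circ> \<Phi>) ` ?D \<subseteq> e ` Z" using ZD by auto
    show "(e \<circ> \<Phi>) x \<in> e ` Y \<longleftrightarrow> nrm n x = 1" if x: "x \<in> ?D" for x
    proof
      assume "nrm n x = 1" then show "(e \<circ> \<Phi>) x \<in> e ` Y" using bdY[OF x] by simp
    next
      assume "(e \<circ> \<Phi>) x \<in> e ` Y"
      then have "\<Phi> x \<in> Y"
        using inj_on_image_mem_iff[OF inje _ YZ, of "\<Phi> x"] x ZD by auto
      then have "x \<notin> ?O" using \<Phi>c disj by auto
      then show "nrm n x = 1" using x by (auto simp: disc_def)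
    qed
    have "continuous_map (top_of_set (e ` c)) K d"
      using d(1) continuous_map_from_subtopology_mono[of euclidean "e ` Z" K d "e ` c"]
      by (auto simp: continuous_map_in_subtopology Z_def)
    then have "continuous_map (top_of_set (e ` c)) (subtopology K c) d"
      using d(2) by (auto simp: continuous_map_in_subtopology Z_def)
    from continuous_map_compose[OF this conth]
    show "continuous_on (e ` Z - e ` Y) (h \<circ> d)"
      unfolding diff by (simp add: continuous_map_in_subtopology)
    show "(h \<circ> d) ` (e ` Z - e ` Y) \<subseteq> ?D"
      unfolding diff using d(2) hO by (auto simp: Z_def)
    show "(e \<circ> \<Phi>) ((h \<circ> d) z) = z" if "z \<in> e ` Z - e ` Y" for z
      using that d(2) \<Phi>h unfolding diff by (auto simp: Z_def)
  qed
  then show ?thesis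
    unfolding embeds_as_nbhd_retract_def using cptZ conte inje by (auto simp: Z_def)
qed

text \<open>The clause on characteristic maps in \<open>CW_structure\<close>, taken relative to an
  arbitrary family \<open>E\<close>: the finite witness is replaced by all cells of \<open>E\<close>
  of lower dimension, so the clause can be stated for finite subfamilies.\<close>

definition cell_attached :: "'k topology \<Rightarrow> (nat \<times> 'k set) set \<Rightarrow> nat \<Rightarrow> 'k set \<Rightarrow> bool" where
  "cell_attached K E n c \<longleftrightarrow>
     (\<exists>\<Phi>. continuous_map (closed_disc n) K \<Phi> \<and>
        homeomorphic_map (subtopology (closed_disc n) (open_disc n)) (subtopology K c) \<Phi> \<and>
        \<Phi> ` disc_boundary n \<subseteq> \<Union>(snd ` {q \<in> E. fst q < n}))"

text \<open>The combinatorial part of being a subcomplex: every cell has its boundary inside the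
  family.\<close>

definition cell_complete :: "'k topology \<Rightarrow> (nat \<times> 'k set) set \<Rightarrow> bool" where
  "cell_complete K E \<longleftrightarrow> (\<forall>p\<in>E. cell_attached K E (fst p) (snd p))"

text \<open>Only cells of dimension below \<open>n\<close> matter, so a family may be enlarged, and
  cells of dimension at least \<open>n\<close> may be removed.\<close>

lemma cell_attached_mono:
  assumes "cell_attached K E n c" "{q \<in> E. fst q < n} \<subseteq> E'"
  shows "cell_attached K E' n c"
proof -
  have "{q \<in> E. fst q < n} \<subseteq> {q \<in> E'. fst q < n}" using assms(2) by auto
  then have "\<Union>(snd ` {q \<in> E. fst q < n}) \<subseteq> \<Union>(snd ` {q \<in> E'. fst q < n})"
    by (intro Union_mono image_mono)
  then show ?thesis
    using assms(1) unfolding cell_attached_def by (meson order_trans)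
qed

lemma cell_complete_Union:
  assumes "\<And>E. E \<in> \<E> \<Longrightarrow> cell_complete K E"
  shows "cell_complete K (\<Union>\<E>)"
  unfolding cell_complete_def
proof
  fix p assume "p \<in> \<Union>\<E>"
  then obtain E where E: "E \<in> \<E>" "p \<in> E" by blast
  then have "cell_attached K E (fst p) (snd p)"
    using assms unfolding cell_complete_def by simp
  then show "cell_attached K (\<Union>\<E>) (fst p) (snd p)"
    by (rule cell_attached_mono) (use E(1) in blast)
qed

text \<open>Cells are added in order of dimension. The last one has maximal dimension, so no other
  boundary relies on it and the remaining family is still complete.\<close>

lemma embeds_as_nbhd_retract_finite_complex:
  assumes "finite E" "Hausdorff_space K" "cell_complete K E" "disjoint_family_on snd E"
    and "\<And>p. p \<in> E \<Longrightarrow> snd p \<subseteq> topspace K"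
  shows "embeds_as_nbhd_retract K (\<Union>(snd ` E))"
  using assms(1,3-)
proof (induction rule: finite_ranking_induct[where f = fst])
  case empty
  have "nbhd_retract ({} :: (nat \<Rightarrow> real) set)" unfolding nbhd_retract_def by (intro exI[of _ "{}"]) auto
  moreover have "continuous_map (subtopology K {}) euclidean (\<lambda>_. (\<lambda>_. 0) :: nat \<Rightarrow> real)"
    by simp
  ultimately show ?case
    unfolding embeds_as_nbhd_retract_def
    by (intro conjI exI[of _ "\<lambda>_. (\<lambda>_. 0) :: nat \<Rightarrow> real"]) simp_all
next
  case (insert p E)
  show ?case
  \<comment> \<open>The induction rule does not guarantee that the inserted cell is new, while
    disjointness from the earlier cells requires it.\<close>
  proof (cases "p \<in> E")
    case True
    then have eq: "insert p E = E" by auto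
    show ?thesis using insert.prems unfolding eq by (rule insert.IH)
  next
    case False
    have attached: "cell_attached K E (fst q) (snd q)" if "q \<in> insert p E" for q
    proof (rule cell_attached_mono)
      show "cell_attached K (insert p E) (fst q) (snd q)"
        using bspec[OF insert.prems(1)[unfolded cell_complete_def] that] .
      have "fst q \<le> fst p" using insert.hyps(2)[of q] that by auto
      then show "{r \<in> insert p E. fst r < fst q} \<subseteq> E" by auto
    qed
    then have "cell_complete K E" unfolding cell_complete_def by simp
    moreover have "disjoint_family_on snd E"
      using insert.prems(2) by (rule disjoint_family_on_mono[rotated]) auto
    ultimately have IH: "embeds_as_nbhd_retract K (\<Union>(snd ` E))"
      using insert.prems(3) by (intro insert.IH) simp_all
    from attached[of p] obtain \<Phi> where \<Phi>: "continuous_map (closed_disc (fst p)) K \<Phi>"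
        "homeomorphic_map (subtopology (closed_disc (fst p)) (open_disc (fst p))) (subtopology K (snd p)) \<Phi>"
        "\<Phi> ` disc_boundary (fst p) \<subseteq> \<Union>(snd ` {q \<in> E. fst q < fst p})"
      unfolding cell_attached_def by auto
    have "\<Union>(snd ` {q \<in> E. fst q < fst p}) \<subseteq> \<Union>(snd ` E)"
      by (intro Union_mono image_mono) auto
    with \<Phi>(3) have bd: "\<Phi> ` disc_boundary (fst p) \<subseteq> \<Union>(snd ` E)" by (rule order_trans)
    have "snd p \<inter> snd q = {}" if "q \<in> E" for q
    proof -
      have "p \<noteq> q" using that False by auto
      then show ?thesis
        using disjoint_family_onD[OF insert.prems(2), of p q] that by simp
    qed
    then have disj: "snd p \<inter> \<Union>(snd ` E) = {}" by auto
    have "snd p \<subseteq> topspace K" by (rule insert.prems(3)) simp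
    with assms(2) IH \<Phi>(1,2) bd disj have "embeds_as_nbhd_retract K (\<Union>(snd ` E) \<union> snd p)"
      by (rule embeds_as_nbhd_retract_attach_cell)
    moreover have "\<Union>(snd ` insert p E) = \<Union>(snd ` E) \<union> snd p" by auto
    ultimately show ?thesis by simp
  qed
qed

subsection \<open>Compact subsets of CW complexes\<close>

context
  fixes K :: "'k topology" and E
  assumes CW: "CW_structure K E"
begin

lemma CW_Hausdorff: "Hausdorff_space K"
  and CW_cover: "(\<Union>(n, e)\<in>E. e) = topspace K"
  and CW_disjoint: "disjoint_family_on snd E"
  using CW by (simp_all add: CW_structure_def)

lemma CW_char:
  assumes "(n, c) \<in> E"
  obtains \<Phi> D where "continuous_map (closed_disc n) K \<Phi>"
    "homeomorphic_map (subtopology (closed_disc n) (open_disc n)) (subtopology K c) \<Phi>"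
    "D \<subseteq> E" "finite D" "\<forall>q\<in>D. fst q < n" "\<Phi> ` disc_boundary n \<subseteq> \<Union>(snd ` D)"
proof -
  have "\<forall>(n, e)\<in>E. \<exists>\<Phi>.
        continuous_map (closed_disc n) K \<Phi> \<and>
        homeomorphic_map (subtopology (closed_disc n) (open_disc n)) (subtopology K e) \<Phi> \<and>
        (\<exists>D\<subseteq>E. finite D \<and> (\<forall>(m, d)\<in>D. m < n) \<and> \<Phi> ` disc_boundary n \<subseteq> (\<Union>(m, d)\<in>D. d))"
    using CW by (simp add: CW_structure_def)
  from bspec[OF this assms] obtain \<Phi> D where *: "continuous_map (closed_disc n) K \<Phi>"
    "homeomorphic_map (subtopology (closed_disc n) (open_disc n)) (subtopology K c) \<Phi>"
    "D \<subseteq> E" "finite D" "\<forall>(m, d)\<in>D. m < n" "\<Phi> ` disc_boundary n \<subseteq> (\<Union>(m, d)\<in>D. d)"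
    by auto
  have "(\<Union>(m, d)\<in>D. d) = \<Union>(snd ` D)" "\<forall>q\<in>D. fst q < n"
    using *(5) by (simp_all add: split_beta)
  with * show ?thesis by (intro that[of \<Phi> D]) simp_all
qed

text \<open>The image of the closed disc is compact, hence closed, and contains the cell; it
  consists of the cell and the image of the boundary, which finitely many cells cover.\<close>

lemma CW_cell_closure:
  assumes "(n, c) \<in> E"
  obtains D where "D \<subseteq> E" "finite D" "K closure_of c \<subseteq> \<Union>(snd ` D)"
proof -
  obtain \<Phi> D where \<Phi>: "continuous_map (closed_disc n) K \<Phi>"
    "homeomorphic_map (subtopology (closed_disc n) (open_disc n)) (subtopology K c) \<Phi>"
    "D \<subseteq> E" "finite D" "\<Phi> ` disc_boundary n \<subseteq> \<Union>(snd ` D)"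
    by (rule CW_char[OF assms])
  have cK: "c \<subseteq> topspace K" using CW_cover assms by auto
  have img: "\<Phi> ` open_disc n = c"
  proof -
    have "disc n \<inter> open_disc n = open_disc n" "topspace K \<inter> c = c"
      using cK by (auto simp: open_disc_eq)
    then show ?thesis
      using homeomorphic_imp_surjective_map[OF \<Phi>(2)] by (simp add: closed_disc_eq)
  qed
  have "compactin K (\<Phi> ` disc n)"
    using \<Phi>(1) image_compactin[of "closed_disc n" "disc n" K \<Phi>] compact_disc
    by (simp add: closed_disc_eq compactin_subtopology)
  then have "closedin K (\<Phi> ` disc n)" by (simp add: CW_Hausdorff compactin_imp_closedin)
  moreover have "c \<subseteq> \<Phi> ` disc n" using img by (auto simp: open_disc_eq)
  ultimately have "K closure_of c \<subseteq> \<Phi> ` disc n" by (simp add: closure_of_minimal)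
  also have "disc n = open_disc n \<union> disc_boundary n"
    by (auto simp: open_disc_eq disc_boundary_eq) (auto simp: disc_def)
  also have "\<Phi> ` (open_disc n \<union> disc_boundary n) \<subseteq> \<Union>(snd ` insert (n, c) D)"
    using img \<Phi>(5) by auto
  finally show ?thesis using \<Phi>(3,4) assms by (intro that[of "insert (n, c) D"]) auto
qed

text \<open>Induction on dimension: the boundary meets only finitely many needed cells of lower
  dimension, and the union of their hulls together with the cell itself is complete.\<close>

lemma CW_cell_hull:
  assumes "(n, c) \<in> E"
  shows "\<exists>H\<subseteq>E. finite H \<and> (n, c) \<in> H \<and> cell_complete K H"
  using assms
proof (induction n arbitrary: c rule: less_induct)
  case (less n)
  obtain \<Phi> D where \<Phi>: "continuous_map (closed_disc n) K \<Phi>"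
    "homeomorphic_map (subtopology (closed_disc n) (open_disc n)) (subtopology K c) \<Phi>"
    "D \<subseteq> E" "finite D" "\<forall>q\<in>D. fst q < n" "\<Phi> ` disc_boundary n \<subseteq> \<Union>(snd ` D)"
    by (rule CW_char[OF less.prems])
  have "\<forall>q\<in>D. \<exists>H\<subseteq>E. finite H \<and> q \<in> H \<and> cell_complete K H"
  proof
    fix q assume "q \<in> D"
    moreover obtain m d where "q = (m, d)" by force
    ultimately show "\<exists>H\<subseteq>E. finite H \<and> q \<in> H \<and> cell_complete K H"
      using less.IH[of m d] bspec[OF \<Phi>(5), of q] subsetD[OF \<Phi>(3), of q] by simp
  qed
  from bchoice[OF this] obtain H
    where "\<forall>q\<in>D. H q \<subseteq> E \<and> finite (H q) \<and> q \<in> H q \<and> cell_complete K (H q)" ..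
  then have H: "\<And>q. q \<in> D \<Longrightarrow> H q \<subseteq> E \<and> finite (H q) \<and> q \<in> H q \<and> cell_complete K (H q)"
    by simp
  define G where "G = \<Union>(H ` D)"
  have G: "cell_complete K G" unfolding G_def using H by (intro cell_complete_Union) auto
  have "D \<subseteq> {q \<in> insert (n, c) G. fst q < n}"
  proof
    fix q assume "q \<in> D"
    then have "q \<in> G" "fst q < n" using H[of q] \<Phi>(5) unfolding G_def by blast+
    then show "q \<in> {q \<in> insert (n, c) G. fst q < n}" by simp
  qed
  then have "\<Union>(snd ` D) \<subseteq> \<Union>(snd ` {q \<in> insert (n, c) G. fst q < n})"
    by (intro Union_mono image_mono)
  with \<Phi>(6) have "\<Phi> ` disc_boundary n \<subseteq> \<Union>(snd ` {q \<in> insert (n, c) G. fst q < n})"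
    by (rule order_trans)
  with \<Phi>(1,2) have "cell_attached K (insert (n, c) G) n c"
    unfolding cell_attached_def by (intro exI[of _ \<Phi>] conjI)
  moreover have "cell_attached K (insert (n, c) G) (fst p) (snd p)" if "p \<in> G" for p
    by (rule cell_attached_mono[of _ G]) (use G that in \<open>auto simp: cell_complete_def\<close>)
  ultimately have "cell_complete K (insert (n, c) G)"
    unfolding cell_complete_def by simp
  moreover have "finite G" "G \<subseteq> E" unfolding G_def using H \<Phi>(4) by auto
  ultimately show ?case using less.prems by (intro exI[of _ "insert (n, c) G"]) auto
qed

text \<open>A choice of one point of \<open>S\<close> in each cell that meets \<open>S\<close> is a set all of whose subsets are
  closed, hence a discrete compact set.\<close>

lemma CW_compact_meets_finitely_many:
  assumes S: "compactin K S"
  shows "finite {p \<in> E. snd p \<inter> S \<noteq> {}}"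
proof -
  define P where "P = {p \<in> E. snd p \<inter> S \<noteq> {}}"
  have "\<forall>p\<in>P. \<exists>x. x \<in> snd p \<inter> S" by (auto simp: P_def)
  then obtain pt where pt: "\<And>p. p \<in> P \<Longrightarrow> pt p \<in> snd p \<inter> S" by metis
  have SK: "S \<subseteq> topspace K" using compactin_subset_topspace[OF S] .
  \<comment> \<open>Cells are disjoint, so a chosen point determines its cell. This bounds the
    number of chosen points in a finite union of cells.\<close>
  have same: "p = q" if "p \<in> P" "q \<in> E" "pt p \<in> snd q" for p q
    using disjoint_family_onD[OF CW_disjoint, of p q] pt[OF that(1)] that by (auto simp: P_def)
  have inj: "inj_on pt P"
  proof (rule inj_onI)
    fix p q assume "p \<in> P" "q \<in> P" "pt p = pt q"
    then show "p = q" using same[of p q] pt[of q] by (auto simp: P_def)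
  qed
  define A where "A = pt ` P"
  have AS: "A \<subseteq> S" using pt by (auto simp: A_def)
  have closed: "closedin K B" if "B \<subseteq> A" for B
  proof -
    \<comment> \<open>The closure of a cell lies in finitely many cells, each containing at most one
      chosen point. The intersection is therefore finite, and the weak topology makes
      \<open>B\<close> closed.\<close>
    have "closedin K (B \<inter> K closure_of c)" if nc: "(n, c) \<in> E" for n c
    proof -
      obtain D where D: "D \<subseteq> E" "finite D" "K closure_of c \<subseteq> \<Union>(snd ` D)"
        by (rule CW_cell_closure[OF nc])
      have "B \<inter> K closure_of c \<subseteq> pt ` D"
      proof
        fix x assume x: "x \<in> B \<inter> K closure_of c"
        then obtain p where p: "p \<in> P" "x = pt p" using \<open>B \<subseteq> A\<close> by (auto simp: A_def)
        moreover obtain q where "q \<in> D" "x \<in> snd q" using x D(3) by auto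
        ultimately show "x \<in> pt ` D" using same[of p q] D(1) by auto
      qed
      then have "finite (B \<inter> K closure_of c)" using D(2) by (meson finite_imageI finite_subset)
      moreover have "B \<inter> K closure_of c \<subseteq> topspace K" using \<open>B \<subseteq> A\<close> AS SK by auto
      ultimately show ?thesis
        by (intro closedin_Hausdorff_finite CW_Hausdorff)
    qed
    then have "\<forall>(n, c)\<in>E. closedin K (B \<inter> K closure_of c)" by auto
    moreover have "B \<subseteq> topspace K" using that AS SK by auto
    ultimately show ?thesis using CW by (simp add: CW_structure_def)
  qed
  have AK: "A \<subseteq> topspace K" using AS SK by auto
  have "openin (subtopology K A) {x}" if "x \<in> A" for x
  proof -
    have "closedin (subtopology K A) (A - {x})"
      using closed[of "A - {x}"] by (simp add: closedin_closed_subtopology closed)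
    then have "openin (subtopology K A) (topspace (subtopology K A) - (A - {x}))" by blast
    moreover have "topspace (subtopology K A) - (A - {x}) = {x}" using AK that by auto
    ultimately show ?thesis by simp
  qed
  then have "subtopology K A = discrete_topology A"
    using AK by (metis discrete_topology_unique topspace_subtopology_subset)
  moreover have "compactin K A" using closed_compactin[OF S AS closed] by simp
  ultimately have "finite A"
    by (metis compact_space_discrete_topology compactin_subspace)
  then have "finite P" using inj by (simp add: A_def finite_image_iff)
  then show ?thesis by (simp add: P_def)
qed

text \<open>The hulls of the finitely many cells that meet \<open>S\<close> form a finite complete
  family.\<close>

lemma CW_compact_subset_embeds:
  assumes S: "compactin K S"
  obtains Y where "S \<subseteq> Y" "embeds_as_nbhd_retract K Y"
proof -
  let ?P = "{p \<in> E. snd p \<inter> S \<noteq> {}}"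
  have "\<forall>p\<in>E. \<exists>H\<subseteq>E. finite H \<and> p \<in> H \<and> cell_complete K H" using CW_cell_hull by auto
  from bchoice[OF this] obtain H
    where "\<forall>p\<in>E. H p \<subseteq> E \<and> finite (H p) \<and> p \<in> H p \<and> cell_complete K (H p)" ..
  then have H: "\<And>p. p \<in> E \<Longrightarrow> H p \<subseteq> E \<and> finite (H p) \<and> p \<in> H p \<and> cell_complete K (H p)"
    by simp
  define G where "G = \<Union>(H ` ?P)"
  have G: "finite G" "cell_complete K G" "G \<subseteq> E"
    unfolding G_def using H CW_compact_meets_finitely_many[OF S]
    by (auto intro!: cell_complete_Union)
  have "embeds_as_nbhd_retract K (\<Union>(snd ` G))"
  proof (rule embeds_as_nbhd_retract_finite_complex[OF G(1) CW_Hausdorff G(2)])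
    show "disjoint_family_on snd G" using disjoint_family_on_mono[OF G(3) CW_disjoint] .
    show "snd p \<subseteq> topspace K" if "p \<in> G" for p using that G(3) CW_cover by (auto simp: split_beta)
  qed
  moreover have "S \<subseteq> \<Union>(snd ` G)"
  proof
    fix x assume "x \<in> S"
    then have "x \<in> (\<Union>(n, e)\<in>E. e)" using compactin_subset_topspace[OF S] CW_cover by auto
    then obtain p where "p \<in> E" "x \<in> snd p" by auto
    then have "p \<in> ?P" using \<open>x \<in> S\<close> by auto
    then have "p \<in> G" using H[OF \<open>p \<in> E\<close>] unfolding G_def by blast
    then show "x \<in> \<Union>(snd ` G)" using \<open>x \<in> snd p\<close> by auto
  qed
  ultimately show ?thesis using that by blast
qed

end

section \<open>Extension to a neighbourhood for CW targets, and the equivalence for families\<close>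

lemma CW_complex_imp_Hausdorff_space: "CW_complex K \<Longrightarrow> Hausdorff_space K"
  by (auto simp: CW_complex_def CW_structure_def)

text \<open>This provides \<open>ext\<close> for a CW target. The extension is made for the embedded
  copy of \<open>Y\<close> and carried back by \<open>d\<close>, so its values stay in the compact
  set \<open>Y\<close>.\<close>

lemma CW_complex_nbhd_extension:
  assumes K: "CW_complex K" and Z: "compact_space Z" "normal_space Z" and B: "closedin Z B"
    and f: "continuous_map (subtopology Z B) K f"
  shows "\<exists>W Y g. openin Z W \<and> B \<subseteq> W \<and> compactin K Y \<and>
        continuous_map (subtopology Z W) (subtopology K Y) g \<and> (\<forall>x\<in>B. g x = f x)"
proof -
  obtain E where E: "CW_structure K E" using K by (auto simp: CW_complex_def)
  have BZ: "B \<subseteq> topspace Z" using closedin_subset[OF B] .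
  have "compactin (subtopology Z B) B"
    using closedin_compact_space[OF Z(1) B] by (simp add: compactin_subtopology)
  then have "compactin K (f ` B)" using f by (rule image_compactin)
  then obtain Y where Y: "f ` B \<subseteq> Y" "embeds_as_nbhd_retract K Y"
    using CW_compact_subset_embeds[OF E] by metis
  obtain e :: "_ \<Rightarrow> nat \<Rightarrow> real" where cptY: "compactin K Y" and
    e: "continuous_map (subtopology K Y) euclidean e" "inj_on e Y" "nbhd_retract (e ` Y)"
    using Y(2) by (auto simp: embeds_as_nbhd_retract_def)
  obtain d where d: "continuous_map (top_of_set (e ` Y)) (subtopology K Y) d" "\<And>y. y \<in> Y \<Longrightarrow> d (e y) = y"
    using compact_subset_inverse[OF cptY e(1,2)] by metis
  have "continuous_map (subtopology Z B) (subtopology K Y) f"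
    using f Y(1) by (auto simp: continuous_map_in_subtopology)
  moreover have "continuous_map (subtopology K Y) (top_of_set (e ` Y)) e"
    using e(1) by (auto simp: continuous_map_in_subtopology)
  ultimately have "continuous_map (subtopology Z B) (top_of_set (e ` Y)) (e \<circ> f)"
    by (rule continuous_map_compose)
  then obtain W g where W: "openin Z W" "B \<subseteq> W" "continuous_map (subtopology Z W) (top_of_set (e ` Y)) g"
    "\<And>x. x \<in> B \<Longrightarrow> g x = (e \<circ> f) x"
    using nbhd_retract_extend[OF e(3) Z(2) B] by metis
  have "continuous_map (subtopology Z W) (subtopology K Y) (d \<circ> g)"
    using W(3) d(1) by (rule continuous_map_compose)
  moreover have "\<forall>x\<in>B. (d \<circ> g) x = f x" using W(4) d(2) Y(1) by auto
  ultimately show ?thesis using W(1,2) cptY by (intro exI conjI)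
qed

theorem proposition2p2:
  fixes X :: "'a topology" and \<F> :: "('k, 'l) map_family"
  assumes "paracompact_space X" and "CW_map_family \<F>"
  shows "tau_cm_family X \<F> \<longleftrightarrow> tau_family (stone_cech X) \<F>"
proof -
  have nor: "normal_space X" using assms(1) by (rule paracompact_imp_normal_space)
  have "tau_cm X K L i \<longleftrightarrow> tau (stone_cech X) K L i" if "(K, L, i) \<in> \<F>" for K L i
  proof
    have KLi: "CW_complex K" "CW_complex L" "continuous_map K L i"
      using assms(2) that by (auto simp: CW_map_family_def)
    show "tau_cm X K L i" if "tau (stone_cech X) K L i"
      using tau_cm_if_tau_stone_cech[OF nor CW_complex_imp_Hausdorff_space[OF KLi(1)] that] .
    show "tau (stone_cech X) K L i" if "tau_cm X K L i"
      using tau_stone_cech_if_tau_cm[OF nor KLi(3) CW_complex_imp_Hausdorff_space[OF KLi(2)] that]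
        CW_complex_nbhd_extension[OF KLi(1) compact_space_stone_cech normal_space_stone_cech] .
  qed
  then show ?thesis by (auto simp: tau_cm_family_def tau_family_def)
qed

end
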